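(* Let $G$ be a group with a symmetric triangular presentation $\langle S\mid R\rangle$ and let $M$ be the associated generalized Dowling geometry. If $M$ is entropic, then there exist $n\in\mathbb N$ and a group homomorphism $\rho:G\to S_n$ with $\rho(s)\neq\rho(s')$ for all distinct $s,s'\in S$.
   Context: A presentation $\langle S\mid R\rangle$ is symmetric triangular if: $S$ and $R$ are finite and the neutral element $e$ is a generator in $S$; for every $e\neq s\in S$ also a (formal) inverse $s^{-1}\in S$, and $ss^{-1}e\in R$; all relators in $R$ are words of length three in $S$ (not necessarily reduced); if $abc\in R$ then $bca,cab\in R$ and $c^{-1}b^{-1}a^{-1}\in R$; and $eee\in R$. The generalized Dowling geometry of $\langle S\mid R\rangle$ is the simple rank-$3$ matroid on $E=\{b_1,b_2,b_3\}\cup\{s_i: s\in S,\ 1\le i\le 3\}$ (three copies of each generator) in which the rank-2 flats containing at least three elements are: $\{b_1,b_2\}\cup\{s_1\}_{s\in S}$, $\{b_2,b_3\}\cup\{s_2\}_{s\in S}$, $\{b_3,b_1\}\cup\{s_3\}_{s\in S}$, and $\{s_i,s'_j,s''_k\}$ for each relator $s''s's\in R$ and each cyclic shift $(i,j,k)$ of $(1,2,3)$; equivalently, a 3-element subset of $E$ is dependent iff it lies in one of these flats, and all sets of size at most two are independent. A matroid $M=(E,r)$ is entropic if there exist discrete random variables $\{X_e\}_{e\in E}$ and $\lambda>0$ with $r(A)=\lambda H(X_A)$ for all $A\subseteq E$ ($H$ the Shannon entropy of the joint variable $X_A$). $S_n$ is the symmetric group. *)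

theory Defs
  imports "HOL-Algebra.Sym_Groups" "HOL-Probability.Information"
begin

section \<open>Group presentations\<close>

text \<open>
  A letter \<open>(s, True)\<close> stands for the generator \<open>s\<close> and \<open>(s, False)\<close> for its inverse in the
  free group on \<open>S\<close>.
\<close>

type_synonym 's word = "('s \<times> bool) list"

abbreviation words :: "'s set \<Rightarrow> 's word set" where
  "words S \<equiv> lists (S \<times> UNIV)"

definition pos_word :: "'s list \<Rightarrow> 's word" where
  "pos_word = map (\<lambda>s. (s, True))"

inductive_set pres_rel :: "'s set \<Rightarrow> 's list set \<Rightarrow> ('s word \<times> 's word) set"
  for S :: "'s set" and R :: "'s list set" where
  refl: "w \<in> words S \<Longrightarrow> (w, w) \<in> pres_rel S R"
| sym: "(v, w) \<in> pres_rel S R \<Longrightarrow> (w, v) \<in> pres_rel S R"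
| trans: "(u, v) \<in> pres_rel S R \<Longrightarrow> (v, w) \<in> pres_rel S R \<Longrightarrow> (u, w) \<in> pres_rel S R"
| cancel: "u \<in> words S \<Longrightarrow> v \<in> words S \<Longrightarrow> s \<in> S \<Longrightarrow>
    (u @ [(s, b), (s, \<not> b)] @ v, u @ v) \<in> pres_rel S R"
| relator: "u \<in> words S \<Longrightarrow> v \<in> words S \<Longrightarrow> r \<in> R \<Longrightarrow> set r \<subseteq> S \<Longrightarrow>
    (u @ pos_word r @ v, u @ v) \<in> pres_rel S R"

text \<open>
  The group \<open>\<langle>S | R\<rangle>\<close>, for relators that are words in the generators (without inverse letters).
\<close>

definition presented_group :: "'s set \<Rightarrow> 's list set \<Rightarrow> 's word set monoid" where
  "presented_group S R =
    \<lparr> carrier = words S // pres_rel S R,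
      mult = (\<lambda>A B. \<Union>a\<in>A. \<Union>b\<in>B. pres_rel S R `` {a @ b}),
      one = pres_rel S R `` {[]} \<rparr>"

text \<open>
  \<open>G\<close> is the group \<open>\<langle>S | R\<rangle>\<close>, where \<open>\<iota> s\<close> is the element of \<open>G\<close> given by the generator \<open>s\<close>.
  The map \<open>\<iota>\<close> need not be injective on \<open>S\<close>.
\<close>

definition has_presentation ::
    "('g, 'b) monoid_scheme \<Rightarrow> ('s \<Rightarrow> 'g) \<Rightarrow> 's set \<Rightarrow> 's list set \<Rightarrow> bool" where
  "has_presentation G \<iota> S R \<longleftrightarrow> group G \<and>
    (\<exists>\<psi> \<in> iso (presented_group S R) G. \<forall>s\<in>S. \<psi> (pres_rel S R `` {pos_word [s]}) = \<iota> s)"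

lemma pres_rel_words: "(v, w) \<in> pres_rel S R \<Longrightarrow> v \<in> words S \<and> w \<in> words S"
  by (induction rule: pres_rel.induct) (auto simp: pos_word_def)

lemma equiv_pres_rel: "equiv (words S) (pres_rel S R)"
proof (rule equivI)
  show "pres_rel S R \<subseteq> words S \<times> words S"
    using pres_rel_words by fastforce
  show "refl_on (words S) (pres_rel S R)"
    by (auto simp: refl_on_def intro: pres_rel.refl)
  show "sym (pres_rel S R)"
    by (rule symI) (rule pres_rel.sym)
  show "trans (pres_rel S R)"
    by (rule transI) (rule pres_rel.trans)
qed

lemma pres_rel_ctxt:
  assumes "(v, w) \<in> pres_rel S R" "x \<in> words S" "y \<in> words S"
  shows "(x @ v @ y, x @ w @ y) \<in> pres_rel S R"
  using assms
proof (induction rule: pres_rel.induct)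
  case (cancel u v s b)
  then show ?case
    using pres_rel.cancel[of "x @ u" S "v @ y" s b R] by simp
next
  case (relator u v r)
  then show ?case
    using pres_rel.relator[of "x @ u" S "v @ y" r R] by simp
next
  case (refl w)
  then show ?case by (intro pres_rel.refl) simp
next
  case (sym v w)
  show ?case by (rule pres_rel.sym[OF sym.IH[OF sym.prems]])
next
  case (trans u v w)
  show ?case by (rule pres_rel.trans[OF trans.IH(1)[OF trans.prems] trans.IH(2)[OF trans.prems]])
qed

lemma pres_rel_append:
  assumes "(a, a') \<in> pres_rel S R" "(b, b') \<in> pres_rel S R"
  shows "(a @ b, a' @ b') \<in> pres_rel S R"
proof -
  have "(a @ b, a' @ b) \<in> pres_rel S R"
    using pres_rel_ctxt[OF assms(1), of "[]" b] pres_rel_words[OF assms(2)] by simp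
  moreover have "(a' @ b, a' @ b') \<in> pres_rel S R"
    using pres_rel_ctxt[OF assms(2), of a' "[]"] pres_rel_words[OF assms(1)] by simp
  ultimately show ?thesis by (rule pres_rel.trans)
qed

lemma presented_group_mult:
  assumes "a \<in> words S" "b \<in> words S"
  shows "pres_rel S R `` {a} \<otimes>\<^bsub>presented_group S R\<^esub> pres_rel S R `` {b} = pres_rel S R `` {a @ b}"
proof -
  let ?r = "pres_rel S R"
  have eq: "?r `` {a' @ b'} = ?r `` {a @ b}" if "a' \<in> ?r `` {a}" "b' \<in> ?r `` {b}" for a' b'
    using that equiv_class_eq[OF equiv_pres_rel pres_rel_append] by blast
  have "?r `` {a} \<noteq> {}" "?r `` {b} \<noteq> {}"
    using assms pres_rel.refl by blast+
  then have "(\<Union>a'\<in>?r `` {a}. \<Union>b'\<in>?r `` {b}. ?r `` {a @ b}) = ?r `` {a @ b}"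
    by simp
  then show ?thesis
    unfolding presented_group_def by (simp add: eq cong: SUP_cong_simp)
qed

lemma pres_rel_inverse:
  "w \<in> words S \<Longrightarrow> (rev (map (\<lambda>(s, b). (s, \<not> b)) w) @ w, []) \<in> pres_rel S R"
proof (induction w)
  case Nil
  then show ?case by (auto intro: pres_rel.refl)
next
  case (Cons x w)
  obtain s b where x: "x = (s, b)" by fastforce
  let ?v = "rev (map (\<lambda>(s, b). (s, \<not> b)) w)"
  have "?v \<in> words S" "w \<in> words S" "s \<in> S"
    using Cons.prems x by auto
  then have "(?v @ [(s, \<not> b), (s, \<not> \<not> b)] @ w, ?v @ w) \<in> pres_rel S R"
    by (intro pres_rel.cancel)
  from pres_rel.trans[OF this Cons.IH[OF \<open>w \<in> words S\<close>]] show ?case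
    by (simp add: x)
qed

lemma group_presented_group: "group (presented_group S R)"
proof (rule groupI)
  have carr: "carrier (presented_group S R) = words S // pres_rel S R"
    and one: "\<one>\<^bsub>presented_group S R\<^esub> = pres_rel S R `` {[]}"
    by (simp_all add: presented_group_def)
  fix x assume "x \<in> carrier (presented_group S R)"
  then obtain a where a: "a \<in> words S" "x = pres_rel S R `` {a}"
    by (metis carr quotientE)
  show "\<one>\<^bsub>presented_group S R\<^esub> \<otimes>\<^bsub>presented_group S R\<^esub> x = x"
    using a by (simp add: one presented_group_mult)
  let ?a' = "rev (map (\<lambda>(s, b). (s, \<not> b)) a)"
  have "?a' \<in> words S" using a by auto
  then show "\<exists>y\<in>carrier (presented_group S R). y \<otimes>\<^bsub>presented_group S R\<^esub> x = \<one>\<^bsub>presented_group S R\<^esub>"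
    using a equiv_class_eq[OF equiv_pres_rel pres_rel_inverse[OF a(1)]]
    by (intro bexI[of _ "pres_rel S R `` {?a'}"])
       (simp_all add: one carr presented_group_mult quotientI)
  fix y assume "y \<in> carrier (presented_group S R)"
  then obtain b where b: "b \<in> words S" "y = pres_rel S R `` {b}"
    by (metis carr quotientE)
  show "x \<otimes>\<^bsub>presented_group S R\<^esub> y \<in> carrier (presented_group S R)"
    using a b by (simp add: carr presented_group_mult quotientI)
  fix z assume "z \<in> carrier (presented_group S R)"
  then obtain c where c: "c \<in> words S" "z = pres_rel S R `` {c}"
    by (metis carr quotientE)
  show "x \<otimes>\<^bsub>presented_group S R\<^esub> y \<otimes>\<^bsub>presented_group S R\<^esub> z =
      x \<otimes>\<^bsub>presented_group S R\<^esub> (y \<otimes>\<^bsub>presented_group S R\<^esub> z)"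
    using a b c by (simp add: presented_group_mult)
qed (simp add: presented_group_def quotientI)

text \<open>
  Formal inversion is an involution \<open>sinv\<close> of the set \<open>S\<close>, with \<open>e\<inverse> = e\<close>; the latter
  gives a meaning to the inverted relators that contain \<open>e\<close>. A generator may be its own formal
  inverse.

  These conditions do not force \<open>e\<close> to be trivial in \<open>\<langle>S | R\<rangle>\<close>: sending every generator
  to \<open>1\<close> in \<open>\<int>/3\<int>\<close> respects all relators of length three. That \<open>e\<close> denotes the neutral element
  is an additional relator \<open>[e]\<close>, so the group presented by such data is
  \<open>presented_group S (insert [e] R)\<close>.
\<close>

definition symmetric_triangular ::
    "'s \<Rightarrow> ('s \<Rightarrow> 's) \<Rightarrow> 's set \<Rightarrow> 's list set \<Rightarrow> bool" where
  "symmetric_triangular e sinv S R \<longleftrightarrow>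
    finite S \<and> finite R \<and> e \<in> S \<and>
    sinv e = e \<and> (\<forall>s\<in>S. sinv s \<in> S \<and> sinv (sinv s) = s) \<and>
    (\<forall>s\<in>S. s \<noteq> e \<longrightarrow> [s, sinv s, e] \<in> R) \<and>
    (\<forall>w\<in>R. length w = 3 \<and> set w \<subseteq> S) \<and>
    (\<forall>a b c. [a, b, c] \<in> R \<longrightarrow>
      [b, c, a] \<in> R \<and> [c, a, b] \<in> R \<and> [sinv c, sinv b, sinv a] \<in> R) \<and>
    [e, e, e] \<in> R"

section \<open>Generalized Dowling geometries\<close>

definition matroid :: "'a set \<Rightarrow> ('a set \<Rightarrow> nat) \<Rightarrow> bool" where
  "matroid E r \<longleftrightarrow> finite E \<and>
    (\<forall>A. A \<subseteq> E \<longrightarrow> r A \<le> card A) \<and>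
    (\<forall>A B. A \<subseteq> B \<longrightarrow> B \<subseteq> E \<longrightarrow> r A \<le> r B) \<and>
    (\<forall>A B. A \<subseteq> E \<longrightarrow> B \<subseteq> E \<longrightarrow> r (A \<union> B) + r (A \<inter> B) \<le> r A + r B)"

text \<open>\<open>Base i\<close> is \<open>b\<^sub>i\<close> and \<open>Copy s i\<close> is \<open>s\<^sub>i\<close>, for \<open>i \<in> {1, 2, 3}\<close>.\<close>

datatype 's dowling_elem = Base nat | Copy 's nat

definition dowling_ground :: "'s set \<Rightarrow> 's dowling_elem set" where
  "dowling_ground S = Base ` {1, 2, 3} \<union> {Copy s i |s i. s \<in> S \<and> i \<in> {1, 2, 3}}"

definition dowling_lines :: "'s set \<Rightarrow> 's list set \<Rightarrow> 's dowling_elem set set" where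
  "dowling_lines S R =
    {{Base 1, Base 2} \<union> {Copy s 1 |s. s \<in> S},
     {Base 2, Base 3} \<union> {Copy s 2 |s. s \<in> S},
     {Base 3, Base 1} \<union> {Copy s 3 |s. s \<in> S}} \<union>
    {{Copy s i, Copy s' j, Copy s'' k} |s s' s'' i j k.
      [s'', s', s] \<in> R \<and> (i, j, k) \<in> {(1, 2, 3), (2, 3, 1), (3, 1, 2)}}"

definition dowling_indep :: "'s set \<Rightarrow> 's list set \<Rightarrow> 's dowling_elem set \<Rightarrow> bool" where
  "dowling_indep S R A \<longleftrightarrow> A \<subseteq> dowling_ground S \<and> card A \<le> 3 \<and>
    (card A = 3 \<longrightarrow> \<not> (\<exists>L \<in> dowling_lines S R. A \<subseteq> L))"

definition dowling_rank :: "'s set \<Rightarrow> 's list set \<Rightarrow> 's dowling_elem set \<Rightarrow> nat" where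
  "dowling_rank S R A = Max (card ` {I. I \<subseteq> A \<and> dowling_indep S R I})"

section \<open>Entropic matroids\<close>

definition joint_var :: "('a \<Rightarrow> 'w \<Rightarrow> 'v) \<Rightarrow> 'a set \<Rightarrow> 'w \<Rightarrow> 'a \<Rightarrow> 'v" where
  "joint_var X A = (\<lambda>\<omega>. restrict (\<lambda>a. X a \<omega>) A)"

definition discrete_random_variable :: "'w measure \<Rightarrow> ('w \<Rightarrow> 'v) \<Rightarrow> bool" where
  "discrete_random_variable P Y \<longleftrightarrow>
    Y \<in> P \<rightarrow>\<^sub>M count_space UNIV \<and> countable (Y ` space P)"

text \<open>
  Countably infinite ranges are allowed. The integral defining \<open>entropy\<close> defaults to \<open>0\<close> when
  it diverges, so \<open>H(Y) = h\<close> for a real number \<open>h\<close> includes that the entropy is finite.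
\<close>

definition has_shannon_entropy :: "'w measure \<Rightarrow> ('w \<Rightarrow> 'v) \<Rightarrow> real \<Rightarrow> bool" where
  "has_shannon_entropy P Y h \<longleftrightarrow>
    (\<exists>f. information_space.finite_entropy P 2 (count_space (Y ` space P)) Y f) \<and>
    prob_space.entropy P 2 (count_space (Y ` space P)) Y = h"

text \<open>
  HOL cannot quantify over the type \<open>'w\<close> of outcomes and the type \<open>'v\<close> of values inside a formula,
  so they are parameters; a theorem with this hypothesis for type variables \<open>'w\<close>, \<open>'v\<close> covers all
  probability spaces and all value types.
\<close>

definition entropic ::
    "'w itself \<Rightarrow> 'v itself \<Rightarrow> 'a set \<Rightarrow> ('a set \<Rightarrow> nat) \<Rightarrow> bool" where
  "entropic _ _ E r \<longleftrightarrow> matroid E r \<and>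
    (\<exists>(P :: 'w measure) (X :: 'a \<Rightarrow> 'w \<Rightarrow> 'v) (c :: real).
      prob_space P \<and> (\<forall>a\<in>E. discrete_random_variable P (X a)) \<and> c > 0 \<and>
      (\<forall>A. A \<subseteq> E \<longrightarrow>
        (\<exists>h. has_shannon_entropy P (joint_var X A) h \<and> real (r A) = c * h)))"

end

theory Submission
  imports
    Defs
    "HOL-Algebra.Bij"
    "HOL-Algebra.Zassenhaus"
    "HOL-Probability.Probability_Mass_Function"
begin

text \<open>
  Three variables on a line are pairwise independent and any two determine the third, so they are
  uniform on finite sets. Fixing a value of \<open>s\<^sub>i\<close> gives a bijection from the values of \<open>b\<^sub>i\<close> to
  those of \<open>b\<^bsub>i+1\<^esub>\<close>; three such bijections, one for each \<open>i\<close>, form a permutation of the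
  disjoint union of the three value sets. Let \<open>F\<^sub>s\<close> be the set of these permutations. The line of
  a relator \<open>s'' s' s\<close> says that for \<open>x \<in> F\<^sub>s\<close> and \<open>y \<in> F\<^bsub>s'\<^esub>\<close> the inverse of \<open>y x\<close> lies in
  \<open>F\<^bsub>s''\<^esub>\<close>. Hence the quotients of elements of \<open>F\<^sub>e\<close> form a group \<open>H\<close>, every \<open>F\<^sub>s\<close> is a left
  and right coset of \<open>H\<close>, and in the normalizer of \<open>H\<close> modulo \<open>H\<close> the cosets satisfy all
  relators except \<open>[e]\<close>. Dividing by the central element \<open>F\<^sub>e\<close> repairs this. Distinct generators
  have disjoint cosets because \<open>s\<^sub>1\<close> and \<open>s'\<^sub>1\<close> together determine \<open>b\<^sub>1\<close>.
\<close>

section \<open>Homomorphisms from presented groups\<close>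

context group
begin

primrec eval_word :: "('s \<Rightarrow> 'a) \<Rightarrow> 's word \<Rightarrow> 'a" where
  "eval_word f [] = \<one>"
| "eval_word f (x # w) = (if snd x then f (fst x) else inv (f (fst x))) \<otimes> eval_word f w"

lemma eval_word_closed:
  assumes "f \<in> S \<rightarrow> carrier G" "w \<in> words S"
  shows "eval_word f w \<in> carrier G"
  using assms(2) by (induction w) (use funcset_mem[OF assms(1)] in auto)

lemma eval_word_append:
  assumes f: "f \<in> S \<rightarrow> carrier G" and "v \<in> words S" "w \<in> words S"
  shows "eval_word f (v @ w) = eval_word f v \<otimes> eval_word f w"
  using assms(2)
proof (induction v)
  case Nil
  then show ?case using eval_word_closed[OF f assms(3)] by simp
next
  case (Cons x v)
  then have "f (fst x) \<in> carrier G" "eval_word f v \<in> carrier G"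
    using funcset_mem[OF f] eval_word_closed[OF f] by auto
  with Cons show ?case
    using eval_word_closed[OF f assms(3)] by (simp add: m_assoc)
qed

lemma eval_word_pres_rel:
  assumes f: "f \<in> S \<rightarrow> carrier G"
    and relators: "\<And>r. r \<in> R \<Longrightarrow> set r \<subseteq> S \<Longrightarrow> eval_word f (pos_word r) = \<one>"
    and "(v, w) \<in> pres_rel S R"
  shows "eval_word f v = eval_word f w"
  using assms(3)
proof (induction rule: pres_rel.induct)
  case (cancel u v s b)
  then have "[(s, b), (s, \<not> b)] \<in> words S" "eval_word f [(s, b), (s, \<not> b)] = \<one>"
    using funcset_mem[OF f] by auto
  with cancel show ?case
    using eval_word_closed[OF f] by (simp only: eval_word_append[OF f] append_in_lists_conv l_one)
next
  case (relator u v r)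
  then have "pos_word r \<in> words S" by (auto simp: pos_word_def)
  with relator show ?case
    using eval_word_closed[OF f] relators by (simp add: eval_word_append[OF f])
qed auto

lemma presented_group_hom:
  assumes f: "f \<in> S \<rightarrow> carrier G"
    and relators: "\<And>r. r \<in> R \<Longrightarrow> set r \<subseteq> S \<Longrightarrow> eval_word f (pos_word r) = \<one>"
  obtains \<phi> where "\<phi> \<in> hom (presented_group S R) G"
    and "\<And>s. s \<in> S \<Longrightarrow> \<phi> (pres_rel S R `` {pos_word [s]}) = f s"
proof -
  let ?P = "presented_group S R"
  define \<phi> where "\<phi> A = the_elem (eval_word f ` A)" for A
  have class_value: "\<phi> (pres_rel S R `` {w}) = eval_word f w" if "w \<in> words S" for w
  proof -
    have "eval_word f v = eval_word f w" if "v \<in> pres_rel S R `` {w}" for v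
      using eval_word_pres_rel[OF f relators, of R w v] that by simp
    then have "eval_word f ` pres_rel S R `` {w} = {eval_word f w}"
      using pres_rel.refl[OF that] by blast
    then show ?thesis by (simp add: \<phi>_def)
  qed
  have class_rep: "\<exists>w \<in> words S. A = pres_rel S R `` {w}" if "A \<in> carrier ?P" for A
    using that by (auto simp: presented_group_def elim: quotientE)
  have "\<phi> \<in> hom ?P G"
  proof (rule homI)
    fix A assume "A \<in> carrier ?P"
    then obtain v where v: "v \<in> words S" "A = pres_rel S R `` {v}" using class_rep by blast
    then show "\<phi> A \<in> carrier G" using class_value eval_word_closed[OF f] by simp
    fix B assume "B \<in> carrier ?P"
    then obtain w where w: "w \<in> words S" "B = pres_rel S R `` {w}" using class_rep by blast
    show "\<phi> (A \<otimes>\<^bsub>?P\<^esub> B) = \<phi> A \<otimes> \<phi> B"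
      using v w by (simp add: presented_group_mult class_value eval_word_append[OF f])
  qed
  moreover have "\<phi> (pres_rel S R `` {pos_word [s]}) = f s" if "s \<in> S" for s
    using that funcset_mem[OF f] by (subst class_value) (auto simp: pos_word_def)
  ultimately show thesis by (rule that)
qed

lemma has_presentation_hom:
  assumes K: "has_presentation K \<iota> S R" and f: "f \<in> S \<rightarrow> carrier G"
    and relators: "\<And>r. r \<in> R \<Longrightarrow> set r \<subseteq> S \<Longrightarrow> eval_word f (pos_word r) = \<one>"
  obtains \<phi> where "\<phi> \<in> hom K G" and "\<And>s. s \<in> S \<Longrightarrow> \<phi> (\<iota> s) = f s"
proof -
  let ?P = "presented_group S R"
  obtain \<phi> where \<phi>: "\<phi> \<in> hom ?P G" "\<And>s. s \<in> S \<Longrightarrow> \<phi> (pres_rel S R `` {pos_word [s]}) = f s"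
    using presented_group_hom[OF f relators] by blast
  obtain \<psi> where \<psi>: "\<psi> \<in> iso ?P K" "\<And>s. s \<in> S \<Longrightarrow> \<psi> (pres_rel S R `` {pos_word [s]}) = \<iota> s"
    using K unfolding has_presentation_def by blast
  let ?\<psi>' = "inv_into (carrier ?P) \<psi>"
  have "?\<psi>' \<in> hom K ?P"
    using group.iso_set_sym[OF group_presented_group \<psi>(1)] by (simp add: iso_def)
  then have "\<phi> \<circ> ?\<psi>' \<in> hom K G" using \<phi>(1) by (rule Group.hom_compose)
  moreover have "(\<phi> \<circ> ?\<psi>') (\<iota> s) = f s" if s: "s \<in> S" for s
  proof -
    have "inj_on \<psi> (carrier ?P)" using \<psi>(1) by (simp add: iso_def bij_betw_def)
    moreover have "pres_rel S R `` {pos_word [s]} \<in> carrier ?P"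
      using s by (auto simp: presented_group_def pos_word_def intro!: quotientI)
    ultimately have "?\<psi>' (\<iota> s) = pres_rel S R `` {pos_word [s]}"
      using \<psi>(2)[OF s] by (metis inv_into_f_f)
    then show ?thesis using \<phi>(2)[OF s] by simp
  qed
  ultimately show thesis by (rule that)
qed

section \<open>Permutation groups\<close>

theorem finite_embeds_in_sym_group:
  assumes "finite (carrier G)"
  obtains \<theta> where "\<theta> \<in> hom G (sym_group (card (carrier G)))" and "inj_on \<theta> (carrier G)"
proof -
  let ?I = "{1..card (carrier G)}"
  obtain enum where enum: "bij_betw enum ?I (carrier G)"
    using ex_bij_betw_nat_finite_1[OF assms] by blast
  define index where "index = inv_into ?I enum"
  have index_props: "index x \<in> ?I" "enum (index x) = x" if "x \<in> carrier G" for x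
    using enum that bij_betw_apply[OF bij_betw_inv_into[OF enum]]
    by (auto simp: index_def bij_betw_inv_into_right)
  have enum_props: "enum k \<in> carrier G" "index (enum k) = k" if "k \<in> ?I" for k
    using enum that by (auto simp: index_def bij_betw_inv_into_left bij_betw_apply)
  define \<theta> where "\<theta> a k = (if k \<in> ?I then index (a \<otimes> enum k) else k)" for a k
  have \<theta>_mult: "\<theta> (a \<otimes> b) = \<theta> a \<circ> \<theta> b" if "a \<in> carrier G" "b \<in> carrier G" for a b
    using that index_props enum_props by (auto simp: fun_eq_iff \<theta>_def m_assoc)
  have \<theta>_one: "\<theta> \<one> = id"
    using enum_props by (auto simp: fun_eq_iff \<theta>_def)
  have "\<theta> a permutes ?I" if a: "a \<in> carrier G" for a
  proof (rule bij_imp_permutes)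
    have "\<theta> a \<circ> \<theta> (inv a) = id" "\<theta> (inv a) \<circ> \<theta> a = id"
      using a \<theta>_mult[symmetric] \<theta>_one by auto
    moreover have "\<theta> b ` ?I \<subseteq> ?I" if "b \<in> carrier G" for b
      using that index_props(1) enum_props(1) by (auto simp: \<theta>_def)
    ultimately show "bij_betw (\<theta> a) ?I ?I"
      using a by (intro bij_betw_byWitness[where f' = "\<theta> (inv a)"]) (auto simp: fun_eq_iff)
  qed (auto simp: \<theta>_def)
  then have "\<theta> \<in> hom G (sym_group (card (carrier G)))"
    using \<theta>_mult by (auto intro!: homI simp: sym_group_carrier sym_group_mult)
  moreover have "inj_on \<theta> (carrier G)"
  proof (rule inj_onI)
    fix a b assume ab: "a \<in> carrier G" "b \<in> carrier G" "\<theta> a = \<theta> b"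
    have "\<theta> c (index \<one>) = index c" if "c \<in> carrier G" for c
      using that index_props[OF one_closed] by (simp add: \<theta>_def)
    then have "index a = index b" using ab by metis
    then show "a = b" using ab index_props(2) by metis
  qed
  ultimately show thesis by (rule that)
qed

end

lemma finite_Bij:
  assumes "finite V"
  shows "finite (Bij V)"
proof (rule finite_subset)
  show "Bij V \<subseteq> (\<Pi>\<^sub>E x\<in>V. V)" by (auto simp: Bij_def PiE_def bij_betw_def)
  show "finite (\<Pi>\<^sub>E x\<in>V. V)" using assms by (simp add: finite_PiE)
qed

lemma inv_BijGroup_eq_iff:
  assumes "f \<in> Bij V" "x \<in> V" "y \<in> V"
  shows "(inv\<^bsub>BijGroup V\<^esub> f) x = y \<longleftrightarrow> f y = x"
  using assms by (auto simp: inv_BijGroup Bij_def bij_betw_def f_inv_into_f)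

section \<open>Triangular families of cosets\<close>

lemma (in group) inv_commute:
  assumes x: "x \<in> carrier G" and y: "y \<in> carrier G" and comm: "x \<otimes> y = y \<otimes> x"
  shows "inv x \<otimes> y = y \<otimes> inv x"
proof -
  have "inv x \<otimes> y = inv x \<otimes> (y \<otimes> x) \<otimes> inv x"
    using x y by (simp add: m_assoc)
  also have "\<dots> = inv x \<otimes> (x \<otimes> y) \<otimes> inv x"
    using comm by simp
  also have "\<dots> = y \<otimes> inv x"
    using x y by (simp add: m_assoc[symmetric])
  finally show ?thesis .
qed

lemma (in group) mult_cube_root_of_one:
  assumes "a \<in> carrier G" "b \<in> carrier G" "c \<in> carrier G" and z: "z \<in> carrier G"
    and comm: "z \<otimes> a = a \<otimes> z" "z \<otimes> b = b \<otimes> z" "z \<otimes> c = c \<otimes> z"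
    and cube: "z \<otimes> (z \<otimes> z) = \<one>"
  shows "a \<otimes> z \<otimes> (b \<otimes> z \<otimes> (c \<otimes> z)) = a \<otimes> (b \<otimes> c)"
proof -
  have swap: "x \<otimes> (z \<otimes> t) = z \<otimes> (x \<otimes> t)"
    if "x \<in> {a, b, c}" "t \<in> carrier G" for x t
    using that assms(1-4) comm by (auto simp: m_assoc[symmetric])
  have "a \<otimes> z \<otimes> (b \<otimes> z \<otimes> (c \<otimes> z)) = z \<otimes> (z \<otimes> z) \<otimes> (a \<otimes> (b \<otimes> c))"
    using assms(1-4) by (simp add: m_assoc swap comm[symmetric])
  then show ?thesis using assms(1-3) cube by simp
qed

lemma (in group) mem_normalizer:
  assumes H: "H \<subseteq> carrier G" and x: "x \<in> carrier G" and "x <# H = H #> x"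
  shows "x \<in> normalizer G H"
proof -
  have "x <# H #> inv x = H"
    using assms by (simp add: coset_mult_assoc)
  then show ?thesis
    using H x by (simp add: normalizer_def stabilizer_def)
qed

locale triangular_presentation =
  fixes e :: 's and sinv :: "'s \<Rightarrow> 's" and S :: "'s set" and R :: "'s list set"
  assumes symmetric_triangular: "symmetric_triangular e sinv S R"
begin

lemma e_in_S: "e \<in> S" and sinv_e: "sinv e = e"
  and sinv_closed: "s \<in> S \<Longrightarrow> sinv s \<in> S" and sinv_sinv: "s \<in> S \<Longrightarrow> sinv (sinv s) = s"
  using symmetric_triangular unfolding symmetric_triangular_def by blast+

lemma relator_in_S:
  assumes "[a, b, c] \<in> R"
  shows "a \<in> S" "b \<in> S" "c \<in> S"
proof -
  have "set [a, b, c] \<subseteq> S"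
    using assms symmetric_triangular unfolding symmetric_triangular_def by blast
  then show "a \<in> S" "b \<in> S" "c \<in> S" by simp_all
qed

lemma relatorE:
  assumes "r \<in> R"
  obtains a b c where "r = [a, b, c]"
proof -
  have "length r = 3"
    using assms symmetric_triangular unfolding symmetric_triangular_def by blast
  then show thesis using that by (auto simp: numeral_3_eq_3 length_Suc_conv)
qed

lemma relator_rotate: "[a, b, c] \<in> R \<Longrightarrow> [b, c, a] \<in> R"
  using symmetric_triangular unfolding symmetric_triangular_def by blast

lemma inverse_relators:
  assumes "s \<in> S"
  shows "[s, sinv s, e] \<in> R" "[sinv s, s, e] \<in> R" "[sinv s, e, s] \<in> R" "[s, e, sinv s] \<in> R"
    "[e, s, sinv s] \<in> R" "[e, sinv s, s] \<in> R"
proof -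
  have inverse: "[s, sinv s, e] \<in> R" if "s \<in> S" for s
    using symmetric_triangular that unfolding symmetric_triangular_def by metis
  show R: "[s, sinv s, e] \<in> R" "[sinv s, s, e] \<in> R"
    using inverse[OF assms] inverse[OF sinv_closed[OF assms]] sinv_sinv[OF assms] by simp_all
  then show "[sinv s, e, s] \<in> R" "[s, e, sinv s] \<in> R" "[e, s, sinv s] \<in> R" "[e, sinv s, s] \<in> R"
    by (blast intro: relator_rotate)+
qed

end

lemma (in group) triangular_presentation_hom:
  assumes "triangular_presentation e sinv S R"
    and K: "has_presentation K \<iota> S (insert [e] R)" and f: "f \<in> S \<rightarrow> carrier G"
    and e: "f e = \<one>" and relators: "\<And>a b c. [a, b, c] \<in> R \<Longrightarrow> f a \<otimes> (f b \<otimes> f c) = \<one>"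
  obtains \<phi> where "\<phi> \<in> hom K G" and "\<And>s. s \<in> S \<Longrightarrow> \<phi> (\<iota> s) = f s"
proof (rule has_presentation_hom[OF K f])
  interpret triangular_presentation e sinv S R by fact
  fix r assume "r \<in> insert [e] R"
  then consider (unit) "r = [e]" | (triangle) a b c where "r = [a, b, c]" "[a, b, c] \<in> R"
    by (metis insertE relatorE)
  then show "eval_word f (pos_word r) = \<one>"
  proof cases
    case unit
    then show ?thesis using e by (simp add: pos_word_def)
  next
    case triangle
    then show ?thesis
      using relators relator_in_S funcset_mem[OF f] by (simp add: pos_word_def)
  qed
qed (rule that)

text \<open>
  The relators make \<open>f e\<close> central of order dividing three, so dividing by it preserves them.
\<close>

lemma (in group) triangular_hom_div_unit:
  assumes "triangular_presentation e sinv S R"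
    and K: "has_presentation K \<iota> S (insert [e] R)" and f: "f \<in> S \<rightarrow> carrier G"
    and relators: "\<And>a b c. [a, b, c] \<in> R \<Longrightarrow> f a \<otimes> (f b \<otimes> f c) = \<one>"
  obtains \<phi> where "\<phi> \<in> hom K G" and "\<And>s. s \<in> S \<Longrightarrow> \<phi> (\<iota> s) = f s \<otimes> inv (f e)"
proof -
  interpret triangular_presentation e sinv S R by fact
  define z where "z = inv (f e)"
  have closed: "f s \<in> carrier G" if "s \<in> S" for s using f that by blast
  then have z: "z \<in> carrier G" using e_in_S by (simp add: z_def)
  have central: "z \<otimes> f s = f s \<otimes> z" if s: "s \<in> S" for s
  proof -
    have "f (sinv s) \<otimes> (f s \<otimes> f e) = f (sinv s) \<otimes> (f e \<otimes> f s)"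
      using relators inverse_relators[OF s] by metis
    then have "f e \<otimes> f s = f s \<otimes> f e"
      using closed e_in_S sinv_closed s by simp
    then show ?thesis
      unfolding z_def using closed e_in_S s by (intro inv_commute) auto
  qed
  have "f e \<otimes> (f e \<otimes> f e) = \<one>"
    using relators inverse_relators(1)[OF e_in_S] sinv_e by simp
  then have cube: "z \<otimes> (z \<otimes> z) = \<one>"
    unfolding z_def using closed[OF e_in_S]
    by (metis inv_closed inv_mult_group inv_one m_assoc m_closed)
  have product: "f a \<otimes> z \<otimes> (f b \<otimes> z \<otimes> (f c \<otimes> z)) = \<one>" if "[a, b, c] \<in> R" for a b c
  proof -
    note S = relator_in_S[OF that]
    have "f a \<otimes> z \<otimes> (f b \<otimes> z \<otimes> (f c \<otimes> z)) = f a \<otimes> (f b \<otimes> f c)"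
      using S closed z central cube by (intro mult_cube_root_of_one) auto
    then show ?thesis using relators[OF that] by simp
  qed
  show thesis
  proof (rule triangular_presentation_hom[OF triangular_presentation_axioms K, of "\<lambda>s. f s \<otimes> z"])
    show "(\<lambda>s. f s \<otimes> z) \<in> S \<rightarrow> carrier G" using closed z by auto
    show "f e \<otimes> z = \<one>" using closed[OF e_in_S] by (simp add: z_def)
  qed (use product that in \<open>auto simp: z_def\<close>)
qed

locale triangular_family = group G + triangular_presentation e sinv S R
  for G :: "('a, 'b) monoid_scheme" (structure) and e :: 's and sinv S R +
  fixes F :: "'s \<Rightarrow> 'a set"
  assumes family_subset: "s \<in> S \<Longrightarrow> F s \<subseteq> carrier G"
    and family_nonempty: "s \<in> S \<Longrightarrow> F s \<noteq> {}"
    and family_relator: "[c, b, a] \<in> R \<Longrightarrow> x \<in> F a \<Longrightarrow> y \<in> F b \<Longrightarrow> inv (y \<otimes> x) \<in> F c"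
begin

definition translation_group :: "'a set" where
  "translation_group = {x \<otimes> inv y |x y. x \<in> F e \<and> y \<in> F e}"

lemma family_closed: "s \<in> S \<Longrightarrow> x \<in> F s \<Longrightarrow> x \<in> carrier G"
  using family_subset by blast

lemma translation_group_subset: "translation_group \<subseteq> carrier G"
  using family_closed[OF e_in_S] by (auto simp: translation_group_def)

text \<open>Two relators applied in succession, their inversions cancelling.\<close>

lemma family_mult_quotient:
  assumes s: "s \<in> S" and x: "x \<in> F s" and u: "u \<in> F e" and v: "v \<in> F e"
  shows "inv v \<otimes> u \<otimes> x \<in> F s" "x \<otimes> u \<otimes> inv v \<in> F s"
proof -
  note carr = family_closed[OF s x] family_closed[OF e_in_S u] family_closed[OF e_in_S v]
  have left: "inv (u \<otimes> x) \<in> F (sinv s)"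
    using family_relator[OF inverse_relators(3)[OF s] x u] .
  have right: "inv (x \<otimes> u) \<in> F (sinv s)"
    using family_relator[OF inverse_relators(2)[OF s] u x] .
  show "inv v \<otimes> u \<otimes> x \<in> F s"
    using family_relator[OF inverse_relators(1)[OF s] v left] carr
    by (simp add: inv_mult_group m_assoc)
  show "x \<otimes> u \<otimes> inv v \<in> F s"
    using family_relator[OF inverse_relators(4)[OF s] right v] carr
    by (simp add: inv_mult_group m_assoc)
qed

lemma family_quotient_in_translation_group:
  assumes s: "s \<in> S" and x: "x \<in> F s" and y: "y \<in> F s"
  shows "x \<otimes> inv y \<in> translation_group" "inv y \<otimes> x \<in> translation_group"
proof -
  obtain u where u: "u \<in> F e" using family_nonempty[OF e_in_S] by blast
  note carr = family_closed[OF s x] family_closed[OF s y] family_closed[OF e_in_S u]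
  have "inv (u \<otimes> x) \<in> F (sinv s)" "inv (x \<otimes> u) \<in> F (sinv s)"
    using family_relator inverse_relators[OF s] x u by blast+
  then have "inv (y \<otimes> inv (u \<otimes> x)) \<in> F e" "inv (inv (x \<otimes> u) \<otimes> y) \<in> F e"
    using family_relator inverse_relators[OF s] y by blast+
  then have in_F_e: "u \<otimes> x \<otimes> inv y \<in> F e" "inv y \<otimes> x \<otimes> u \<in> F e"
    using carr by (simp_all add: inv_mult_group m_assoc)
  have "inv u \<otimes> (u \<otimes> x \<otimes> inv y) \<otimes> u \<in> F e"
    using family_mult_quotient(1)[OF e_in_S u in_F_e(1) u] .
  moreover have "x \<otimes> inv y = inv u \<otimes> (u \<otimes> x \<otimes> inv y)"
    using carr by (simp add: inv_solve_left m_assoc)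
  ultimately have "x \<otimes> inv y \<otimes> u \<in> F e" by simp
  moreover have "x \<otimes> inv y = x \<otimes> inv y \<otimes> u \<otimes> inv u" "inv y \<otimes> x = inv y \<otimes> x \<otimes> u \<otimes> inv u"
    using carr by (simp_all add: m_assoc)
  ultimately show "x \<otimes> inv y \<in> translation_group" "inv y \<otimes> x \<in> translation_group"
    using in_F_e(2) u unfolding translation_group_def by blast+
qed

lemma translation_groupE:
  assumes "h \<in> translation_group"
  obtains u v where "u \<in> F e" "v \<in> F e" "h = u \<otimes> inv v"
  using assms by (auto simp: translation_group_def)

lemma mult_translation_right:
  assumes "s \<in> S" "x \<in> F s" "h \<in> translation_group"
  shows "x \<otimes> h \<in> F s"
proof -
  obtain u v where h: "u \<in> F e" "v \<in> F e" "h = u \<otimes> inv v"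
    using assms(3) by (rule translation_groupE)
  then show ?thesis
    using family_mult_quotient(2)[OF assms(1,2) h(1,2)] family_closed e_in_S assms(1,2)
    by (simp add: m_assoc)
qed

lemma mult_translation_left:
  assumes s: "s \<in> S" "x \<in> F s" and "h \<in> translation_group"
  shows "h \<otimes> x \<in> F s"
proof -
  obtain u v where h: "u \<in> F e" "v \<in> F e" "h = u \<otimes> inv v"
    using assms(3) by (rule translation_groupE)
  note carr = family_closed[OF s] family_closed[OF e_in_S h(1)] family_closed[OF e_in_S h(2)]
  have "u \<otimes> u \<otimes> inv v \<in> F e"
    using family_mult_quotient(2)[OF e_in_S h(1) h(1,2)] .
  then have "inv u \<otimes> (u \<otimes> u \<otimes> inv v) \<otimes> x \<in> F s"
    using family_mult_quotient(1)[OF s _ h(1)] by blast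
  moreover have "h = inv u \<otimes> (u \<otimes> u \<otimes> inv v)"
    using carr h(3) by (simp add: inv_solve_left m_assoc)
  ultimately show ?thesis by simp
qed

lemma subgroup_translation_group: "subgroup translation_group G"
proof (rule subgroupI)
  show "translation_group \<subseteq> carrier G" by (rule translation_group_subset)
  show "translation_group \<noteq> {}"
    using family_nonempty[OF e_in_S] by (auto simp: translation_group_def)
next
  fix h assume "h \<in> translation_group"
  then obtain u v where h: "u \<in> F e" "v \<in> F e" "h = u \<otimes> inv v"
    by (rule translation_groupE)
  then have "inv h = v \<otimes> inv u"
    using family_closed[OF e_in_S] by (simp add: inv_mult_group)
  then show "inv h \<in> translation_group" using h by (auto simp: translation_group_def)
next
  fix h k assume h: "h \<in> translation_group" and "k \<in> translation_group"
  then obtain u v where k: "u \<in> F e" "v \<in> F e" "k = u \<otimes> inv v"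
    by (blast elim: translation_groupE)
  have "h \<otimes> u \<in> F e" using mult_translation_left[OF e_in_S k(1) h] .
  moreover have "h \<otimes> k = h \<otimes> u \<otimes> inv v"
    using h k translation_group_subset family_closed[OF e_in_S] by (auto simp: m_assoc)
  ultimately show "h \<otimes> k \<in> translation_group" using k(2) by (auto simp: translation_group_def)
qed

lemma family_eq_coset:
  assumes s: "s \<in> S" and x: "x \<in> F s"
  shows "F s = translation_group #> x" "F s = x <# translation_group"
proof -
  have "y \<in> translation_group #> x" "y \<in> x <# translation_group" if y: "y \<in> F s" for y
  proof -
    have "y = y \<otimes> inv x \<otimes> x"
      using family_closed[OF s y] family_closed[OF s x] by (simp add: m_assoc)
    then show "y \<in> translation_group #> x"
      using family_quotient_in_translation_group(1)[OF s y x] unfolding r_coset_def by blast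
    have "y = x \<otimes> (inv x \<otimes> y)"
      using family_closed[OF s y] family_closed[OF s x] by (simp add: m_assoc[symmetric])
    then show "y \<in> x <# translation_group"
      using family_quotient_in_translation_group(2)[OF s y x] unfolding l_coset_def by blast
  qed
  then show "F s = translation_group #> x" "F s = x <# translation_group"
    using mult_translation_left[OF s x] mult_translation_right[OF s x]
    by (auto simp: r_coset_def l_coset_def)
qed

abbreviation normalizer_group :: "('a, 'b) monoid_scheme" where
  "normalizer_group \<equiv> G\<lparr>carrier := normalizer G translation_group\<rparr>"

abbreviation coset_group :: "'a set monoid" where
  "coset_group \<equiv> normalizer_group Mod translation_group"

lemma normal_translation_group: "normal translation_group normalizer_group"
  by (rule subgroup_in_normalizer[OF subgroup_translation_group])

lemma group_coset_group: "group coset_group"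
  using normal_translation_group by (rule normal.factorgroup_is_group)

lemma finite_coset_group:
  assumes "finite (carrier G)"
  shows "finite (carrier coset_group)"
proof -
  have "carrier coset_group \<subseteq> Pow (carrier G)"
    using subgroup.subset[OF normalizer_imp_subgroup[OF translation_group_subset]]
      translation_group_subset
    by (auto simp: FactGroup_def RCOSETS_def r_coset_def)
  then show ?thesis using assms by (metis finite_Pow_iff finite_subset)
qed

lemma family_in_normalizer:
  assumes "s \<in> S"
  shows "F s \<subseteq> normalizer G translation_group"
proof
  fix x assume "x \<in> F s"
  then show "x \<in> normalizer G translation_group"
    using family_eq_coset[OF assms] family_closed[OF assms] translation_group_subset
    by (intro mem_normalizer) auto
qed

lemma family_in_coset_group:
  assumes "s \<in> S"
  shows "F s \<in> carrier coset_group"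
proof -
  obtain x where "x \<in> F s" using family_nonempty[OF assms] by blast
  then show ?thesis
    using family_eq_coset(1)[OF assms] family_in_normalizer[OF assms]
    by (auto simp: FactGroup_def RCOSETS_def)
qed

lemma family_relator_coset_group:
  assumes R: "[c, b, a] \<in> R"
  shows "F c \<otimes>\<^bsub>coset_group\<^esub> (F b \<otimes>\<^bsub>coset_group\<^esub> F a) = \<one>\<^bsub>coset_group\<^esub>"
proof -
  note S = relator_in_S[OF R]
  obtain x y where x: "x \<in> F a" and y: "y \<in> F b" using family_nonempty S by blast
  let ?z = "inv (y \<otimes> x)"
  have z: "?z \<in> F c" using family_relator[OF R x y] .
  interpret N: normal translation_group normalizer_group
    by (rule normal_translation_group)
  have r_coset: "translation_group #>\<^bsub>normalizer_group\<^esub> w = translation_group #> w" for w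
    by (simp add: r_coset_def)
  have norm: "{x, y, ?z} \<subseteq> normalizer G translation_group"
    using family_in_normalizer S x y z by blast+
  have "F c \<otimes>\<^bsub>coset_group\<^esub> (F b \<otimes>\<^bsub>coset_group\<^esub> F a) = translation_group #> (?z \<otimes> (y \<otimes> x))"
    using N.rcos_sum norm N.m_closed by (simp add: FactGroup_def r_coset
        family_eq_coset(1)[OF S(1) z] family_eq_coset(1)[OF S(2) y] family_eq_coset(1)[OF S(3) x])
  also have "?z \<otimes> (y \<otimes> x) = \<one>"
    using family_closed S x y by simp
  finally show ?thesis
    using translation_group_subset by (simp add: FactGroup_def)
qed

theorem separating_hom:
  assumes fin: "finite (carrier G)" and inj: "inj_on F S"
    and K: "has_presentation K \<iota> S (insert [e] R)"
  obtains n \<rho> where "\<rho> \<in> hom K (sym_group n)" and "inj_on (\<rho> \<circ> \<iota>) S"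
proof -
  interpret Q: group coset_group by (rule group_coset_group)
  obtain \<phi> where \<phi>: "\<phi> \<in> hom K coset_group"
      "\<And>s. s \<in> S \<Longrightarrow> \<phi> (\<iota> s) = F s \<otimes>\<^bsub>coset_group\<^esub> inv\<^bsub>coset_group\<^esub> F e"
    using Q.triangular_hom_div_unit[OF triangular_presentation_axioms K, of F]
      family_in_coset_group family_relator_coset_group by blast
  obtain \<theta> where \<theta>: "\<theta> \<in> hom coset_group (sym_group (card (carrier coset_group)))"
      "inj_on \<theta> (carrier coset_group)"
    using finite_coset_group[OF fin] by (rule Q.finite_embeds_in_sym_group)
  have "inj_on (\<phi> \<circ> \<iota>) S"
  proof (rule inj_onI)
    fix s t assume st: "s \<in> S" "t \<in> S" and "(\<phi> \<circ> \<iota>) s = (\<phi> \<circ> \<iota>) t"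
    then have "F s \<otimes>\<^bsub>coset_group\<^esub> inv\<^bsub>coset_group\<^esub> F e =
        F t \<otimes>\<^bsub>coset_group\<^esub> inv\<^bsub>coset_group\<^esub> F e"
      using \<phi>(2) by (metis comp_apply)
    then have "F s = F t"
      using st e_in_S by (metis Q.inv_closed Q.right_cancel family_in_coset_group)
    then show "s = t" using inj st by (auto dest: inj_onD)
  qed
  moreover have "(\<phi> \<circ> \<iota>) ` S \<subseteq> carrier coset_group"
    using family_in_coset_group e_in_S \<phi>(2) by (auto simp del: mult_FactGroup)
  ultimately have "inj_on (\<theta> \<circ> \<phi> \<circ> \<iota>) S"
    using \<theta>(2) by (metis comp_inj_on comp_assoc inj_on_subset)
  moreover have "\<theta> \<circ> \<phi> \<in> hom K (sym_group (card (carrier coset_group)))"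
    using \<phi>(1) \<theta>(1) by (rule Group.hom_compose)
  ultimately show thesis by (rule that[rotated])
qed

end

section \<open>Entropy of discrete distributions\<close>

definition pmf_entropy :: "'a pmf \<Rightarrow> real" where
  "pmf_entropy p = - (\<integral>x. log 2 (pmf p x) \<partial>measure_pmf p)"

definition finite_pmf_entropy :: "'a pmf \<Rightarrow> bool" where
  "finite_pmf_entropy p \<longleftrightarrow> integrable (measure_pmf p) (\<lambda>x. log 2 (pmf p x))"

lemma pmf_entropy_return [simp]: "pmf_entropy (return_pmf x) = 0"
  by (simp add: pmf_entropy_def)

lemma
  assumes "inj_on f (set_pmf p)"
  shows pmf_entropy_map_inj: "pmf_entropy (map_pmf f p) = pmf_entropy p"
    and finite_pmf_entropy_map_inj: "finite_pmf_entropy (map_pmf f p) \<longleftrightarrow> finite_pmf_entropy p"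
proof -
  have eq: "AE x in measure_pmf p. log 2 (pmf (map_pmf f p) (f x)) = log 2 (pmf p x)"
    using assms by (simp add: AE_measure_pmf_iff pmf_map_inj)
  show "pmf_entropy (map_pmf f p) = pmf_entropy p"
    unfolding pmf_entropy_def integral_map_pmf
    by (intro arg_cong[where f = uminus] integral_cong_AE eq) simp_all
  show "finite_pmf_entropy (map_pmf f p) \<longleftrightarrow> finite_pmf_entropy p"
    unfolding finite_pmf_entropy_def integrable_map_pmf_eq
    by (intro integrable_cong_AE eq) simp_all
qed

lemma pmf_eqI_relative_entropy_zero:
  assumes sub: "set_pmf p \<subseteq> set_pmf q"
    and int: "integrable (measure_pmf p) (\<lambda>x. log 2 (pmf p x / pmf q x))"
    and zero: "(\<integral>x. log 2 (pmf p x / pmf q x) \<partial>measure_pmf p) = 0"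
  shows "p = q"
proof -
  interpret q: information_space "measure_pmf q" 2 by unfold_locales simp
  note KL_density = sigma_finite_measure.KL_density[OF measure_pmf.sigma_finite_measure_axioms]
  have p: "measure_pmf p = density (measure_pmf q) (\<lambda>x. pmf p x / pmf q x)"
    unfolding measure_pmf_eq_density[of p] measure_pmf_eq_density[of q]
    using sub by (subst density_density_divide) (auto simp: pmf_eq_0_set_pmf)
  have "integrable (measure_pmf q) (\<lambda>x. pmf p x / pmf q x * log 2 (pmf p x / pmf q x))"
    using int unfolding p by (subst (asm) integrable_density) auto
  moreover have "KL_divergence 2 q (density q (\<lambda>x. pmf p x / pmf q x)) = 0"
    using zero unfolding p by (subst (asm) integral_density) (auto simp: KL_density)
  ultimately have "density (measure_pmf q) (\<lambda>x. pmf p x / pmf q x) = measure_pmf q"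
    by (subst (asm) q.KL_eq_0_iff_eq) (auto simp: p[symmetric] measure_pmf.prob_space_axioms)
  then show ?thesis unfolding p[symmetric] by (simp add: measure_pmf_inject)
qed

lemma independent_if_entropy_additive:
  fixes p :: "('a \<times> 'b) pmf"
  assumes fin: "finite_pmf_entropy p"
      "finite_pmf_entropy (map_pmf fst p)" "finite_pmf_entropy (map_pmf snd p)"
    and add: "pmf_entropy p = pmf_entropy (map_pmf fst p) + pmf_entropy (map_pmf snd p)"
  shows "p = pair_pmf (map_pmf fst p) (map_pmf snd p)"
proof (rule pmf_eqI_relative_entropy_zero)
  let ?q = "pair_pmf (map_pmf fst p) (map_pmf snd p)"
  let ?joint = "\<lambda>x. log 2 (pmf p x)"
    and ?left = "\<lambda>x. log 2 (pmf (map_pmf fst p) (fst x))"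
    and ?right = "\<lambda>x. log 2 (pmf (map_pmf snd p) (snd x))"
  show "set_pmf p \<subseteq> set_pmf ?q" by force
  have split: "log 2 (pmf p x / pmf ?q x) = ?joint x - ?left x - ?right x" if "x \<in> set_pmf p" for x
  proof -
    have "pmf p x > 0" "pmf (map_pmf fst p) (fst x) > 0" "pmf (map_pmf snd p) (snd x) > 0"
      using that by (auto intro!: pmf_positive)
    then show ?thesis
      by (cases x) (simp add: pmf_pair log_divide log_mult)
  qed
  have int: "integrable (measure_pmf p) ?joint" "integrable (measure_pmf p) ?left"
      "integrable (measure_pmf p) ?right"
    using fin by (simp_all add: finite_pmf_entropy_def)
  then show "integrable (measure_pmf p) (\<lambda>x. log 2 (pmf p x / pmf ?q x))"
    by (subst integrable_cong_AE[where g = "\<lambda>x. ?joint x - ?left x - ?right x"])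
      (auto simp: AE_measure_pmf_iff split)
  have "(\<integral>x. log 2 (pmf p x / pmf ?q x) \<partial>p) = (\<integral>x. ?joint x - ?left x - ?right x \<partial>p)"
    by (rule integral_cong_AE) (auto simp: AE_measure_pmf_iff split)
  also have "\<dots> = pmf_entropy (map_pmf fst p) + pmf_entropy (map_pmf snd p) - pmf_entropy p"
    using int by (simp add: pmf_entropy_def)
  finally show "(\<integral>x. log 2 (pmf p x / pmf ?q x) \<partial>p) = 0"
    using add by simp
qed

lemma inj_on_if_entropy_map_eq:
  assumes fin: "finite_pmf_entropy p" "finite_pmf_entropy (map_pmf f p)"
    and eq: "pmf_entropy (map_pmf f p) = pmf_entropy p"
  shows "inj_on f (set_pmf p)"
proof -
  let ?gap = "\<lambda>x. log 2 (pmf (map_pmf f p) (f x)) - log 2 (pmf p x)"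
  have int: "integrable (measure_pmf p) ?gap" and zero: "(\<integral>x. ?gap x \<partial>p) = 0"
    using fin eq by (simp_all add: finite_pmf_entropy_def pmf_entropy_def)
  have fiber: "pmf (map_pmf f p) (f x) = measure p (f -` {f x})" for x
    by (rule pmf_map)
  have pos: "pmf p x > 0" "pmf (map_pmf f p) (f x) > 0" if "x \<in> set_pmf p" for x
    using that by (auto intro: pmf_positive)
  have "pmf p x \<le> pmf (map_pmf f p) (f x)" for x
    unfolding fiber pmf.rep_eq[of p] by (intro measure_pmf.finite_measure_mono) auto
  then have "AE x in measure_pmf p. 0 \<le> ?gap x"
    using pos by (auto simp: AE_measure_pmf_iff)
  then have "AE x in measure_pmf p. ?gap x = 0"
    using integral_nonneg_eq_0_iff_AE[OF int] zero by simp
  then have fiber_eq: "pmf (map_pmf f p) (f x) = pmf p x" if "x \<in> set_pmf p" for x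
    using that pos[OF that] inj_onD[OF log_inj[of 2]] by (auto simp: AE_measure_pmf_iff)
  show ?thesis
  proof (rule inj_onI, rule ccontr)
    fix x y assume xy: "x \<in> set_pmf p" "y \<in> set_pmf p" "f x = f y" "x \<noteq> y"
    then have "pmf p x + pmf p y = measure p {x, y}"
      by (simp add: measure_measure_pmf_finite)
    also have "\<dots> \<le> pmf (map_pmf f p) (f x)"
      unfolding fiber using xy(3) by (intro measure_pmf.finite_measure_mono) auto
    finally show False using fiber_eq[OF xy(1)] pos(1)[OF xy(2)] by simp
  qed
qed

lemma finite_set_pmf_if_uniform:
  assumes uniform: "\<And>x. x \<in> set_pmf p \<Longrightarrow> pmf p x = k"
  shows "finite (set_pmf p)"
proof (rule ccontr)
  assume infinite: "infinite (set_pmf p)"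
  obtain x where "x \<in> set_pmf p" using set_pmf_not_empty by fast
  then have "k > 0" using uniform pmf_positive by metis
  then obtain n :: nat where n: "1 < real n * k" using ex_less_of_nat_mult by blast
  obtain A where A: "finite A" "card A = n" "A \<subseteq> set_pmf p"
    using infinite_arbitrarily_large[OF infinite] by blast
  have "measure p A = (\<Sum>x\<in>A. pmf p x)" using A(1) by (rule measure_measure_pmf_finite)
  also have "\<dots> = (\<Sum>x\<in>A. k)" using A(3) uniform by (intro sum.cong) auto
  finally show False using A(2) n measure_pmf.prob_le_1[of p A] by simp
qed

text \<open>
  Given \<open>f\<close>, the values of \<open>g\<close> and \<open>h\<close> determine each other, so independence from \<open>f\<close> gives
  \<open>P(g = g t) = P(h = h t)\<close>. As \<open>g\<close> and \<open>h\<close> take every pair of values, both are uniform.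
\<close>

lemma finite_image_if_pairwise_independent:
  assumes fg: "map_pmf (\<lambda>t. (f t, g t)) p = pair_pmf (map_pmf f p) (map_pmf g p)"
    and fh: "map_pmf (\<lambda>t. (f t, h t)) p = pair_pmf (map_pmf f p) (map_pmf h p)"
    and gh: "map_pmf (\<lambda>t. (g t, h t)) p = pair_pmf (map_pmf g p) (map_pmf h p)"
    and determined: "\<And>t t'. t \<in> set_pmf p \<Longrightarrow> t' \<in> set_pmf p \<Longrightarrow> f t = f t' \<Longrightarrow>
      g t = g t' \<longleftrightarrow> h t = h t'"
  shows "finite (g ` set_pmf p)"
proof -
  have eq: "pmf (map_pmf g p) (g t) = pmf (map_pmf h p) (h t)" if t: "t \<in> set_pmf p" for t
  proof -
    have "pmf (map_pmf (\<lambda>t. (f t, g t)) p) (f t, g t) = pmf (map_pmf (\<lambda>t. (f t, h t)) p) (f t, h t)"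
      unfolding pmf_map
      by (rule measure_pmf.finite_measure_eq_AE)
        (use determined[OF _ t] in \<open>auto simp: AE_measure_pmf_iff\<close>)
    moreover have "pmf (map_pmf f p) (f t) > 0"
      using t by (intro pmf_positive) simp
    ultimately show ?thesis unfolding fg fh pmf_pair by simp
  qed
  obtain t0 where t0: "t0 \<in> set_pmf p" using set_pmf_not_empty by fast
  have "pmf (map_pmf g p) x = pmf (map_pmf h p) (h t0)" if "x \<in> set_pmf (map_pmf g p)" for x
  proof -
    have "(x, h t0) \<in> set_pmf (map_pmf (\<lambda>t. (g t, h t)) p)"
      unfolding gh using that t0 by simp
    then obtain t where "t \<in> set_pmf p" "x = g t" "h t0 = h t" by auto
    then show ?thesis using eq by simp
  qed
  then have "finite (set_pmf (map_pmf g p))" by (rule finite_set_pmf_if_uniform)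
  then show ?thesis by simp
qed

section \<open>Distributions representing entropic matroids\<close>

lemma pmf_of_countable_range:
  assumes "prob_space P" and Y: "Y \<in> P \<rightarrow>\<^sub>M count_space UNIV" and "countable (Y ` space P)"
  obtains p where "measure_pmf p = distr P (count_space UNIV) Y"
proof -
  interpret prob_space P by fact
  let ?M = "distr P (count_space UNIV) Y"
  interpret M: prob_space ?M using Y by (rule prob_space_distr)
  have "AE x in ?M. x \<in> Y ` space P"
    using Y by (simp add: AE_distr_iff)
  then have "AE x in ?M. measure ?M {x} \<noteq> 0"
    using M.AE_support_countable assms(3) by auto
  then have "measure_pmf (Abs_pmf ?M) = ?M"
    by (intro Abs_pmf_inverse) (auto simp: M.prob_space_axioms)
  then show thesis by (rule that)
qed

lemma has_shannon_entropy_measurable: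
  assumes "prob_space P" and h: "has_shannon_entropy P Y h"
  shows "Y \<in> P \<rightarrow>\<^sub>M count_space UNIV"
proof -
  interpret prob_space P by fact
  interpret information_space P 2 by unfold_locales simp
  have "Y \<in> P \<rightarrow>\<^sub>M count_space (Y ` space P)"
    using h unfolding has_shannon_entropy_def finite_entropy_def distributed_def by blast
  moreover have "id \<in> count_space (Y ` space P) \<rightarrow>\<^sub>M count_space UNIV" by simp
  ultimately have "id \<circ> Y \<in> P \<rightarrow>\<^sub>M count_space UNIV" by (rule measurable_comp)
  then show ?thesis by simp
qed

lemma distributed_count_space_eq_pmf:
  assumes dist: "distributed P (count_space (Y ` space P)) Y (\<lambda>y. ennreal (f y))"
    and nonneg: "\<And>y. y \<in> Y ` space P \<Longrightarrow> 0 \<le> f y"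
    and p: "measure_pmf p = distr P (count_space UNIV) Y" and Y: "Y \<in> P \<rightarrow>\<^sub>M count_space UNIV"
    and y: "y \<in> Y ` space P"
  shows "f y = pmf p y"
proof -
  let ?V = "count_space (Y ` space P)"
  have "ennreal (f y) = emeasure (density ?V f) {y}"
    using y by (simp add: emeasure_density nn_integral_count_space_indicator)
  also have "\<dots> = emeasure (distr P ?V Y) {y}"
    using distributed_distr_eq_density[OF dist] by simp
  also have "\<dots> = emeasure (measure_pmf p) {y}"
    unfolding p using y Y distributed_measurable[OF dist] by (simp add: emeasure_distr)
  finally show ?thesis using nonneg[OF y] by (simp add: emeasure_pmf_single)
qed

lemma has_shannon_entropy_pmf:
  assumes P: "prob_space P" and h: "has_shannon_entropy P Y h"
    and p: "measure_pmf p = distr P (count_space UNIV) Y"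
  shows "finite_pmf_entropy p" and "pmf_entropy p = h"
proof -
  interpret prob_space P by fact
  interpret information_space P 2 by unfold_locales simp
  have Y: "Y \<in> P \<rightarrow>\<^sub>M count_space UNIV"
    using P h by (rule has_shannon_entropy_measurable)
  obtain f where f: "finite_entropy (count_space (Y ` space P)) Y f"
    using h unfolding has_shannon_entropy_def by blast
  note dist = finite_entropy_distributed[OF f] and nonneg = finite_entropy_nn[OF f]
  have log_eq: "log 2 (pmf p (Y \<omega>)) = log 2 (f (Y \<omega>))" if "\<omega> \<in> space P" for \<omega>
    using distributed_count_space_eq_pmf[OF dist _ p Y] nonneg that by simp
  have "integrable P (\<lambda>\<omega>. log 2 (f (Y \<omega>)))"
    using finite_entropy_integrable[OF f]
    by (subst (asm) distributed_integrable[OF dist _ nonneg]) auto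
  then show "finite_pmf_entropy p"
    unfolding finite_pmf_entropy_def p using Y log_eq
    by (simp add: integrable_distr_eq cong: Bochner_Integration.integrable_cong)
  have "h = - (\<integral>y. f y * log 2 (f y) \<partial>count_space (Y ` space P))"
    using entropy_distr[OF dist nonneg] h unfolding has_shannon_entropy_def by simp
  also have "(\<integral>y. f y * log 2 (f y) \<partial>count_space (Y ` space P)) = (\<integral>\<omega>. log 2 (f (Y \<omega>)) \<partial>P)"
    by (rule distributed_integral[OF dist _ nonneg]) auto
  also have "- \<dots> = pmf_entropy p"
    unfolding pmf_entropy_def p using Y log_eq
    by (simp add: integral_distr cong: Bochner_Integration.integral_cong)
  finally show "pmf_entropy p = h" by simp
qed

lemma countable_joint_var:
  assumes "finite A" and "\<And>a. a \<in> A \<Longrightarrow> discrete_random_variable P (X a)"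
  shows "countable (joint_var X A ` space P)"
proof (rule countable_subset)
  show "joint_var X A ` space P \<subseteq> PiE A (\<lambda>a. X a ` space P)"
    by (auto simp: joint_var_def)
  show "countable (PiE A (\<lambda>a. X a ` space P))"
    using assms by (intro countable_PiE) (auto simp: discrete_random_variable_def)
qed

abbreviation marginal :: "('a \<Rightarrow> 'v) pmf \<Rightarrow> 'a set \<Rightarrow> ('a \<Rightarrow> 'v) pmf" where
  "marginal D A \<equiv> map_pmf (\<lambda>t. restrict t A) D"

lemma marginal_marginal: "B \<subseteq> A \<Longrightarrow> marginal (marginal D A) B = marginal D B"
  by (simp add: map_pmf_comp Int_absorb1)

lemma restrict_eq_iff: "restrict f A = restrict g A \<longleftrightarrow> (\<forall>x\<in>A. f x = g x)"
  by (metis restrict_apply' restrict_ext)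

locale entropy_representation =
  fixes E :: "'a set" and r :: "'a set \<Rightarrow> nat" and D :: "('a \<Rightarrow> 'v) pmf" and c :: real
  assumes scale_nonzero: "c \<noteq> 0"
    and finite_entropy_marginal: "A \<subseteq> E \<Longrightarrow> finite_pmf_entropy (marginal D A)"
    and rank_eq_entropy: "A \<subseteq> E \<Longrightarrow> real (r A) = c * pmf_entropy (marginal D A)"
begin

lemma determined:
  assumes AB: "A \<subseteq> B" "B \<subseteq> E" and rank: "r A = r B"
    and t: "t \<in> set_pmf D" "t' \<in> set_pmf D" and agree: "\<forall>x\<in>A. t x = t' x" and "y \<in> B"
  shows "t y = t' y"
proof -
  have "A \<subseteq> E" using AB by blast
  then have "pmf_entropy (marginal D A) = pmf_entropy (marginal D B)"
    using rank_eq_entropy[OF \<open>A \<subseteq> E\<close>] rank_eq_entropy[OF AB(2)] rank scale_nonzero by simp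
  then have inj: "inj_on (\<lambda>t. restrict t A) (set_pmf (marginal D B))"
    using finite_entropy_marginal \<open>A \<subseteq> E\<close> AB marginal_marginal[OF AB(1), of D]
    by (intro inj_on_if_entropy_map_eq) simp_all
  have "restrict (restrict t B) A = restrict (restrict t' B) A"
    using agree AB(1) by (auto simp: restrict_eq_iff)
  then have "restrict t B = restrict t' B"
    by (rule inj_onD[OF inj]) (use t in auto)
  then show ?thesis using \<open>y \<in> B\<close> by (simp add: restrict_eq_iff)
qed

lemma product_marginals:
  assumes AB: "A \<subseteq> E" "B \<subseteq> E" and rank: "r (A \<union> B) = r A + r B"
  shows "map_pmf (\<lambda>t. (restrict t A, restrict t B)) D = pair_pmf (marginal D A) (marginal D B)"
proof -
  let ?f = "\<lambda>u. (restrict u A, restrict u B)"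
  define J where "J = map_pmf ?f (marginal D (A \<union> B))"
  have J: "J = map_pmf ?f D"
    by (simp add: J_def map_pmf_comp Int_absorb1)
  have inj: "inj_on ?f (set_pmf (marginal D (A \<union> B)))"
    by (auto simp: inj_on_def restrict_eq_iff)
  have marginals: "map_pmf fst J = marginal D A" "map_pmf snd J = marginal D B"
    by (simp_all add: J map_pmf_comp)
  have "c * pmf_entropy (marginal D (A \<union> B)) =
      c * (pmf_entropy (marginal D A) + pmf_entropy (marginal D B))"
    using rank rank_eq_entropy[of "A \<union> B"] rank_eq_entropy[OF AB(1)] rank_eq_entropy[OF AB(2)] AB
    by (simp add: algebra_simps)
  then have "pmf_entropy J = pmf_entropy (map_pmf fst J) + pmf_entropy (map_pmf snd J)"
    unfolding marginals unfolding J_def pmf_entropy_map_inj[OF inj] using scale_nonzero by simp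
  moreover have "finite_pmf_entropy J"
    unfolding J_def finite_pmf_entropy_map_inj[OF inj] using finite_entropy_marginal AB by simp
  ultimately have "J = pair_pmf (map_pmf fst J) (map_pmf snd J)"
    using finite_entropy_marginal AB
    by (intro independent_if_entropy_additive) (simp_all add: marginals)
  then show ?thesis unfolding marginals unfolding J .
qed

lemma independent:
  assumes "A \<subseteq> E" "B \<subseteq> E" "r (A \<union> B) = r A + r B" and "t \<in> set_pmf D" "t' \<in> set_pmf D"
  obtains u where "u \<in> set_pmf D" "\<forall>x\<in>A. u x = t x" "\<forall>x\<in>B. u x = t' x"
proof -
  have "(restrict t A, restrict t' B) \<in> set_pmf (map_pmf (\<lambda>t. (restrict t A, restrict t B)) D)"
    unfolding product_marginals[OF assms(1-3)] using assms(4,5) by simp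
  then obtain u where "u \<in> set_pmf D" "restrict u A = restrict t A" "restrict u B = restrict t' B"
    by auto
  then show thesis using that by (simp add: restrict_eq_iff)
qed

lemma nonconstant:
  assumes a: "a \<in> E" "r {a} \<noteq> 0"
  obtains t t' where "t \<in> set_pmf D" "t' \<in> set_pmf D" "t a \<noteq> t' a"
proof -
  have "\<exists>t\<in>set_pmf D. \<exists>t'\<in>set_pmf D. t a \<noteq> t' a"
  proof (rule ccontr)
    assume not_distinct: "\<not> ?thesis"
    obtain t0 where "t0 \<in> set_pmf D" using set_pmf_not_empty by fast
    then have "marginal D {a} = map_pmf (\<lambda>t. restrict t0 {a}) D"
      using not_distinct by (intro map_pmf_cong) (auto simp: restrict_eq_iff)
    then have "real (r {a}) = 0"
      using rank_eq_entropy[of "{a}"] a(1) by (simp add: map_pmf_const)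
    then show False using a(2) by simp
  qed
  then show thesis using that by blast
qed

lemma finite_values:
  assumes "x \<in> E" "y \<in> E" "z \<in> E"
    and "r {x, y} = r {x} + r {y}" "r {x, z} = r {x} + r {z}" "r {y, z} = r {y} + r {z}"
    and "r {x, y, z} = r {x, y}" "r {x, y, z} = r {x, z}"
  shows "finite ((\<lambda>t. t y) ` set_pmf D)"
proof -
  have "finite ((\<lambda>t. restrict t {y}) ` set_pmf D)"
  proof (rule finite_image_if_pairwise_independent)
    show "map_pmf (\<lambda>t. (restrict t {x}, restrict t {y})) D =
        pair_pmf (marginal D {x}) (marginal D {y})"
      "map_pmf (\<lambda>t. (restrict t {x}, restrict t {z})) D =
        pair_pmf (marginal D {x}) (marginal D {z})"
      "map_pmf (\<lambda>t. (restrict t {y}, restrict t {z})) D =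
        pair_pmf (marginal D {y}) (marginal D {z})"
      using assms by (auto intro!: product_marginals simp: insert_commute)
    fix t t' assume t: "t \<in> set_pmf D" "t' \<in> set_pmf D" and "restrict t {x} = restrict t' {x}"
    then have x: "t x = t' x" by (simp add: restrict_eq_iff)
    have "t z = t' z" if "t y = t' y"
      by (rule determined[of "{x, y}" "{x, y, z}"]) (use assms t x that in auto)
    moreover have "t y = t' y" if "t z = t' z"
      by (rule determined[of "{x, z}" "{x, y, z}"]) (use assms t x that in auto)
    ultimately show "restrict t {y} = restrict t' {y} \<longleftrightarrow> restrict t {z} = restrict t' {z}"
      by (auto simp: restrict_eq_iff)
  qed
  then have "finite ((\<lambda>u. u y) ` (\<lambda>t. restrict t {y}) ` set_pmf D)" by (rule finite_imageI)
  then show ?thesis by (simp add: image_image)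
qed

end

lemma entropic_imp_representation:
  assumes entropic: "entropic TYPE('w) TYPE('v) E r"
  obtains D :: "('a \<Rightarrow> 'v) pmf" and c where "entropy_representation E r D c"
proof -
  obtain P :: "'w measure" and X :: "'a \<Rightarrow> 'w \<Rightarrow> 'v" and c where
    P: "prob_space P" and X: "\<And>a. a \<in> E \<Longrightarrow> discrete_random_variable P (X a)" and c: "c > 0"
    and entropy: "\<And>A. A \<subseteq> E \<Longrightarrow> \<exists>h. has_shannon_entropy P (joint_var X A) h \<and> real (r A) = c * h"
    using entropic unfolding entropic_def by auto
  have Y: "joint_var X A \<in> P \<rightarrow>\<^sub>M count_space UNIV" if "A \<subseteq> E" for A
    using entropy[OF that] has_shannon_entropy_measurable[OF P] by blast
  have "finite E" using entropic by (simp add: entropic_def matroid_def)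
  then obtain D where D: "measure_pmf D = distr P (count_space UNIV) (joint_var X E)"
    using pmf_of_countable_range[OF P Y countable_joint_var] X by blast
  have marginal: "measure_pmf (marginal D A) = distr P (count_space UNIV) (joint_var X A)"
    if "A \<subseteq> E" for A
  proof -
    have "(\<lambda>t. restrict t A) \<circ> joint_var X E = joint_var X A"
      using that by (auto simp: joint_var_def fun_eq_iff)
    then show ?thesis
      unfolding map_pmf_rep_eq D using Y[OF order_refl] by (subst distr_distr) auto
  qed
  have "entropy_representation E r D c"
  proof
    show "c \<noteq> 0" using c by simp
    fix A assume A: "A \<subseteq> E"
    obtain h where h: "has_shannon_entropy P (joint_var X A) h" "real (r A) = c * h"
      using entropy[OF A] by blast
    show "finite_pmf_entropy (marginal D A)" "real (r A) = c * pmf_entropy (marginal D A)"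
      using has_shannon_entropy_pmf[OF P h(1) marginal[OF A]] h(2) by simp_all
  qed
  then show thesis by (rule that)
qed

section \<open>Rank and lines of the Dowling geometry\<close>

lemma dowling_rank_eqI:
  assumes "finite A" "I \<subseteq> A" "dowling_indep S R I"
    and "\<And>J. J \<subseteq> A \<Longrightarrow> dowling_indep S R J \<Longrightarrow> card J \<le> card I"
  shows "dowling_rank S R A = card I"
  unfolding dowling_rank_def using assms by (intro Max_eqI) auto

lemma dowling_rank_indep:
  assumes "finite A" "dowling_indep S R A"
  shows "dowling_rank S R A = card A"
  using assms by (intro dowling_rank_eqI) (auto intro: card_mono)

lemma dowling_rank_le_two:
  assumes "finite A" "A \<subseteq> dowling_ground S" "card A \<le> 2"
  shows "dowling_rank S R A = card A"
  using assms by (intro dowling_rank_indep) (auto simp: dowling_indep_def)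

lemma dowling_rank_collinear:
  assumes "finite A" "A \<subseteq> dowling_ground S" "2 \<le> card A" "L \<in> dowling_lines S R" "A \<subseteq> L"
  shows "dowling_rank S R A = 2"
proof -
  obtain I where I: "I \<subseteq> A" "card I = 2"
    using assms(3) by (meson obtain_subset_with_card_n)
  have "dowling_rank S R A = card I"
  proof (rule dowling_rank_eqI[OF assms(1) I(1)])
    show "dowling_indep S R I" using I assms(2) by (auto simp: dowling_indep_def)
    fix J assume "J \<subseteq> A" "dowling_indep S R J"
    then have "card J \<le> 3" "card J \<noteq> 3"
      using assms(4,5) unfolding dowling_indep_def by blast+
    then show "card J \<le> card I" using I(2) by simp
  qed
  then show ?thesis using I(2) by simp
qed

lemma bases_not_collinear:
  assumes "L \<in> dowling_lines S R"
  shows "\<not> {Base 1, Base 2, Base 3} \<subseteq> L"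
  using assms unfolding dowling_lines_def by (elim UnE insertE emptyE CollectE exE conjE) auto

lemma dowling_rank_bases: "dowling_rank S R {Base 1, Base 2, Base 3} = 3"
proof -
  have "dowling_indep S R {Base 1, Base 2, Base 3}"
    using bases_not_collinear by (auto simp: dowling_indep_def dowling_ground_def)
  then show ?thesis by (subst dowling_rank_indep) auto
qed

definition nxt :: "nat \<Rightarrow> nat" where
  "nxt i = (if i = 3 then 1 else Suc i)"

lemma nxt_simps [simp]: "nxt 1 = 2" "nxt (Suc 0) = 2" "nxt 2 = 3" "nxt 3 = 1"
  by (simp_all add: nxt_def)

lemma nxt_closed: "i \<in> {1, 2, 3} \<Longrightarrow> nxt i \<in> {1, 2, 3}"
  and nxt_nxt_nxt: "i \<in> {1, 2, 3} \<Longrightarrow> nxt (nxt (nxt i)) = i"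
  and nxt_neq: "i \<in> {1, 2, 3} \<Longrightarrow> nxt i \<noteq> i"
  by (auto simp: nxt_def)

lemma inj_on_nxt: "inj_on nxt {1, 2, 3}"
  by (auto simp: inj_on_def)

lemma base_in_ground: "i \<in> {1, 2, 3} \<Longrightarrow> Base i \<in> dowling_ground S"
  and copy_in_ground: "i \<in> {1, 2, 3} \<Longrightarrow> s \<in> S \<Longrightarrow> Copy s i \<in> dowling_ground S"
  by (auto simp: dowling_ground_def)

definition side :: "'s set \<Rightarrow> nat \<Rightarrow> 's dowling_elem set" where
  "side S i = {Base i, Base (nxt i)} \<union> {Copy s i |s. s \<in> S}"

lemma side_in_dowling_lines:
  assumes "i \<in> {1, 2, 3}"
  shows "side S i \<in> dowling_lines S R"
proof -
  have "i = 1 \<or> i = 2 \<or> i = 3" using assms by simp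
  then show ?thesis unfolding dowling_lines_def side_def by (elim disjE) simp_all
qed

lemma relator_in_dowling_lines:
  assumes "i \<in> {1, 2, 3}" "[s'', s', s] \<in> R"
  shows "{Copy s i, Copy s' (nxt i), Copy s'' (nxt (nxt i))} \<in> dowling_lines S R"
proof -
  have "(i, nxt i, nxt (nxt i)) \<in> {(1, 2, 3), (2, 3, 1), (3, 1, 2)}"
    using assms(1) by auto
  with assms(2) show ?thesis
    unfolding dowling_lines_def by (intro UnI2 CollectI exI conjI) (rule HOL.refl)
qed

lemma (in triangular_presentation) dowling_line_subset_ground:
  assumes "L \<in> dowling_lines S R"
  shows "L \<subseteq> dowling_ground S"
  using assms relator_in_S unfolding dowling_lines_def dowling_ground_def
  by (elim UnE insertE emptyE CollectE exE conjE) auto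

section \<open>Permutations from the outcomes of a Dowling geometry\<close>

text \<open>
  The elements of \<open>T\<close> are outcomes: \<open>t x\<close> is the value of the random variable belonging to the
  point \<open>x\<close>.
\<close>

locale dowling_support = triangular_presentation e sinv S R
  for e :: 's and sinv S R +
  fixes T :: "('s dowling_elem \<Rightarrow> 'v) set"
  assumes finite_values_base: "i \<in> {1, 2, 3} \<Longrightarrow> finite ((\<lambda>t. t (Base i)) ` T)"
    and nonconstant_base: "\<exists>t\<in>T. \<exists>t'\<in>T. t (Base 1) \<noteq> t' (Base 1)"
    and bases_independent: "t\<^sub>1 \<in> T \<Longrightarrow> t\<^sub>2 \<in> T \<Longrightarrow> t\<^sub>3 \<in> T \<Longrightarrow>
      \<exists>t\<in>T. t (Base 1) = t\<^sub>1 (Base 1) \<and> t (Base 2) = t\<^sub>2 (Base 2) \<and> t (Base 3) = t\<^sub>3 (Base 3)"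
    and pair_independent: "x \<in> dowling_ground S \<Longrightarrow> y \<in> dowling_ground S \<Longrightarrow> x \<noteq> y \<Longrightarrow>
      t \<in> T \<Longrightarrow> t' \<in> T \<Longrightarrow> \<exists>u\<in>T. u x = t x \<and> u y = t' y"
    and line_determined: "L \<in> dowling_lines S R \<Longrightarrow> {x, y, z} \<subseteq> L \<Longrightarrow> x \<noteq> y \<Longrightarrow>
      t \<in> T \<Longrightarrow> t' \<in> T \<Longrightarrow> t x = t' x \<Longrightarrow> t y = t' y \<Longrightarrow> t z = t' z"
begin

lemma bases_independent_cyclic:
  assumes "i \<in> {1, 2, 3}" "t \<in> T" "t' \<in> T" "t'' \<in> T"
  obtains u where "u \<in> T" "u (Base i) = t (Base i)" "u (Base (nxt i)) = t' (Base (nxt i))"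
    "u (Base (nxt (nxt i))) = t'' (Base (nxt (nxt i)))"
proof -
  consider "i = 1" | "i = 2" | "i = 3" using assms(1) by blast
  then show thesis
  proof cases
    case 1
    then show thesis using bases_independent[OF assms(2-4)] that by auto
  next
    case 2
    then show thesis using bases_independent[OF assms(4,2,3)] that by auto
  next
    case 3
    then show thesis using bases_independent[OF assms(3,4,2)] that by auto
  qed
qed

lemma base_copy_independent:
  assumes "i \<in> {1, 2, 3}" "s \<in> S" "t \<in> T" "u \<in> T"
  obtains v where "v \<in> T" "v (Base i) = t (Base i)" "v (Copy s i) = u (Copy s i)"
  using pair_independent[of "Base i" "Copy s i" t u] assms that
  by (auto simp: base_in_ground copy_in_ground)

lemma side_determined:
  assumes "i \<in> {1, 2, 3}" "{x, y, z} \<subseteq> side S i" "x \<noteq> y"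
    and "t \<in> T" "t' \<in> T" "t x = t' x" "t y = t' y"
  shows "t z = t' z"
  using line_determined[OF side_in_dowling_lines] assms by blast

lemma side_determined_iff:
  assumes "i \<in> {1, 2, 3}" "{x, y, z} \<subseteq> side S i" "x \<noteq> y" "x \<noteq> z"
    and "t \<in> T" "t' \<in> T" "t x = t' x"
  shows "t y = t' y \<longleftrightarrow> t z = t' z"
  using side_determined[of i x y z t t'] side_determined[of i x z y t t'] assms
  by (auto simp: insert_commute)

definition base_values :: "(nat \<times> 'v) set" where
  "base_values = {(i, t (Base i)) |i t. i \<in> {1, 2, 3} \<and> t \<in> T}"

lemma base_valuesI: "i \<in> {1, 2, 3} \<Longrightarrow> t \<in> T \<Longrightarrow> (i, t (Base i)) \<in> base_values"
  by (auto simp: base_values_def)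

lemma base_valuesE:
  assumes "w \<in> base_values"
  obtains i t where "i \<in> {1, 2, 3}" "t \<in> T" "w = (i, t (Base i))"
  using assms by (auto simp: base_values_def)

lemma finite_base_values: "finite base_values"
proof -
  have "base_values = (\<Union>i\<in>{1, 2, 3}. Pair i ` (\<lambda>t. t (Base i)) ` T)"
    by (auto simp: base_values_def)
  then show ?thesis using finite_values_base by simp
qed

definition realizes ::
    "(nat \<times> 'v \<Rightarrow> nat \<times> 'v) \<Rightarrow> 's \<Rightarrow> nat \<Rightarrow> ('s dowling_elem \<Rightarrow> 'v) \<Rightarrow> bool" where
  "realizes p s i u \<longleftrightarrow> (\<forall>t\<in>T. t (Copy s i) = u (Copy s i) \<longleftrightarrow>
    p (i, t (Base i)) = (nxt i, t (Base (nxt i))))"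

lemma realizesD:
  "realizes p s i u \<Longrightarrow> t \<in> T \<Longrightarrow>
    t (Copy s i) = u (Copy s i) \<longleftrightarrow> p (i, t (Base i)) = (nxt i, t (Base (nxt i)))"
  by (simp add: realizes_def)

lemma realizes_cong:
  "u (Copy s i) = v (Copy s i) \<Longrightarrow> realizes p s i u \<longleftrightarrow> realizes p s i v"
  by (simp add: realizes_def)

lemma realizes_value:
  assumes p: "realizes p s i u" and "s \<in> S" "i \<in> {1, 2, 3}" "t \<in> T" "u \<in> T"
  obtains v where "v \<in> T" "v (Base i) = t (Base i)" "v (Copy s i) = u (Copy s i)"
    "p (i, t (Base i)) = (nxt i, v (Base (nxt i)))"
proof -
  obtain v where "v \<in> T" "v (Base i) = t (Base i)" "v (Copy s i) = u (Copy s i)"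
    using base_copy_independent[OF assms(3,2,4,5)] .
  then show thesis using that realizesD[OF p] by metis
qed

definition shift_of :: "'s \<Rightarrow> ('s dowling_elem \<Rightarrow> 'v) \<Rightarrow> nat \<times> 'v \<Rightarrow> nat \<times> 'v" where
  "shift_of s u = (\<lambda>(i, x)\<in>base_values.
    (nxt i, (SOME v. v \<in> T \<and> v (Base i) = x \<and> v (Copy s i) = u (Copy s i)) (Base (nxt i))))"

lemma realizes_shift_of:
  assumes s: "s \<in> S" and i: "i \<in> {1, 2, 3}" and u: "u \<in> T"
  shows "realizes (shift_of s u) s i u"
  unfolding realizes_def
proof
  fix t assume t: "t \<in> T"
  define v where "v = (SOME v. v \<in> T \<and> v (Base i) = t (Base i) \<and> v (Copy s i) = u (Copy s i))"
  have "\<exists>v. v \<in> T \<and> v (Base i) = t (Base i) \<and> v (Copy s i) = u (Copy s i)"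
    using base_copy_independent[OF i s t u] by metis
  then have v: "v \<in> T" "v (Base i) = t (Base i)" "v (Copy s i) = u (Copy s i)"
    unfolding v_def by (metis (mono_tags, lifting) someI_ex)+
  have "t (Copy s i) = v (Copy s i) \<longleftrightarrow> t (Base (nxt i)) = v (Base (nxt i))"
    by (rule side_determined_iff[OF i, of "Base i"])
      (use s t v nxt_neq[OF i] in \<open>auto simp: side_def\<close>)
  moreover have "shift_of s u (i, t (Base i)) = (nxt i, v (Base (nxt i)))"
    using base_valuesI[OF i t] by (simp add: shift_of_def v_def)
  ultimately show "t (Copy s i) = u (Copy s i) \<longleftrightarrow>
      shift_of s u (i, t (Base i)) = (nxt i, t (Base (nxt i)))"
    using v(3) by auto
qed

lemma shift_of_value:
  assumes "s \<in> S" "u \<in> T" "w \<in> base_values"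
  obtains i v where "i \<in> {1, 2, 3}" "v \<in> T" "w = (i, v (Base i))" "v (Copy s i) = u (Copy s i)"
    "shift_of s u w = (nxt i, v (Base (nxt i)))"
proof -
  obtain i t where w: "i \<in> {1, 2, 3}" "t \<in> T" "w = (i, t (Base i))"
    using assms(3) by (rule base_valuesE)
  then show thesis
    using realizes_value[OF realizes_shift_of[OF assms(1) w(1) assms(2)] assms(1) w(1,2) assms(2)]
      that
    by metis
qed

lemma inj_on_shift_of:
  assumes s: "s \<in> S" and u: "u \<in> T"
  shows "inj_on (shift_of s u) base_values"
proof (rule inj_onI)
  fix w w'
  assume "w \<in> base_values" "w' \<in> base_values" and eq: "shift_of s u w = shift_of s u w'"
  then obtain i v j v' where v: "i \<in> {1, 2, 3}" "v \<in> T" "w = (i, v (Base i))"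
      "v (Copy s i) = u (Copy s i)" "shift_of s u w = (nxt i, v (Base (nxt i)))"
    and v': "j \<in> {1, 2, 3}" "v' \<in> T" "w' = (j, v' (Base j))"
      "v' (Copy s j) = u (Copy s j)" "shift_of s u w' = (nxt j, v' (Base (nxt j)))"
    by (metis shift_of_value[OF s u])
  have ij: "i = j"
    using eq v(5) v'(5) inj_onD[OF inj_on_nxt _ v(1) v'(1)] by simp
  have "v (Base i) = v' (Base i)"
    by (rule side_determined[OF v(1), of "Base (nxt i)" "Copy s i"])
      (use eq ij s v v' in \<open>auto simp: side_def\<close>)
  then show "w = w'" using v(3) v'(3) ij by simp
qed

lemma shift_of_Bij:
  assumes s: "s \<in> S" and u: "u \<in> T"
  shows "shift_of s u \<in> Bij base_values"
proof -
  have "shift_of s u w \<in> base_values" if "w \<in> base_values" for w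
    using shift_of_value[OF s u that] base_valuesI nxt_closed by metis
  then have "shift_of s u ` base_values = base_values"
    by (intro endo_inj_surj finite_base_values inj_on_shift_of[OF s u]) auto
  then show ?thesis
    using inj_on_shift_of[OF s u] by (simp add: Bij_def bij_betw_def shift_of_def)
qed

definition shifts :: "'s \<Rightarrow> (nat \<times> 'v \<Rightarrow> nat \<times> 'v) set" where
  "shifts s = {p \<in> Bij base_values. \<forall>i\<in>{1, 2, 3}. \<exists>u\<in>T. realizes p s i u}"

lemma shifts_subset: "shifts s \<subseteq> Bij base_values"
  by (auto simp: shifts_def)

lemma shiftsE:
  assumes "p \<in> shifts s" "i \<in> {1, 2, 3}"
  obtains u where "u \<in> T" "realizes p s i u"
  using assms unfolding shifts_def by blast

lemma shifts_nonempty: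
  assumes "s \<in> S"
  shows "shifts s \<noteq> {}"
proof -
  obtain u where "u \<in> T" using nonconstant_base by blast
  then have "shift_of s u \<in> shifts s"
    using shift_of_Bij[OF assms] realizes_shift_of[OF assms] unfolding shifts_def by blast
  then show ?thesis by blast
qed

lemma shifts_disjoint:
  assumes s: "s \<in> S" "s' \<in> S" "s \<noteq> s'"
  shows "shifts s \<inter> shifts s' = {}"
proof (rule ccontr)
  assume "shifts s \<inter> shifts s' \<noteq> {}"
  then obtain p where p: "p \<in> shifts s" "p \<in> shifts s'" by blast
  obtain u where u: "u \<in> T" "realizes p s 1 u" using shiftsE[OF p(1), of 1] by blast
  obtain u' where u': "realizes p s' 1 u'" using shiftsE[OF p(2), of 1] by blast
  have copies: "\<exists>v\<in>T. v (Base 1) = t (Base 1) \<and>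
      v (Copy s 1) = u (Copy s 1) \<and> v (Copy s' 1) = u' (Copy s' 1)"
    if "t \<in> T" for t
    using realizes_value[OF u(2) s(1) _ that u(1)] realizesD[OF u'] by (metis insertI1)
  obtain t t' where "t \<in> T" "t' \<in> T" "t (Base 1) \<noteq> t' (Base 1)" using nonconstant_base by blast
  with copies obtain v v' where v: "v \<in> T" "v' \<in> T" "v (Base 1) \<noteq> v' (Base 1)"
      "v (Copy s 1) = v' (Copy s 1)" "v (Copy s' 1) = v' (Copy s' 1)"
    by metis
  then show False
    using side_determined[of 1 "Copy s 1" "Copy s' 1" "Base 1" v v'] s by (auto simp: side_def)
qed

lemma realizes_compose:
  assumes R: "[c, b, a] \<in> R" and i: "i \<in> {1, 2, 3}" and u: "u \<in> T"
    and p: "realizes p a i u" and q: "realizes q b (nxt i) u" and t: "t \<in> T"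
  shows "t (Copy c (nxt (nxt i))) = u (Copy c (nxt (nxt i))) \<longleftrightarrow>
    q (p (i, t (Base i))) = (nxt (nxt i), t (Base (nxt (nxt i))))"
proof -
  let ?j = "nxt i" and ?k = "nxt (nxt i)"
  note S = relator_in_S[OF R] and j = nxt_closed[OF i]
  note k = nxt_closed[OF j]
  obtain v where v: "v \<in> T" "p (i, t (Base i)) = (?j, v (Base ?j))"
    using realizes_value[OF p S(3) i t u] .
  obtain w where w: "w \<in> T" "q (?j, v (Base ?j)) = (?k, w (Base ?k))"
    using realizes_value[OF q S(2) j v(1) u] .
  obtain t' where t': "t' \<in> T" "t' (Base i) = t (Base i)" "t' (Base ?j) = v (Base ?j)"
      "t' (Base ?k) = w (Base ?k)"
    using bases_independent_cyclic[OF i t v(1) w(1)] .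
  have "t' (Copy a i) = u (Copy a i)" "t' (Copy b ?j) = u (Copy b ?j)"
    using realizesD[OF p t'(1)] realizesD[OF q t'(1)] t' v w by simp_all
  then have "t' (Copy c ?k) = u (Copy c ?k)"
    using line_determined[OF relator_in_dowling_lines[OF i R],
        of "Copy a i" "Copy b ?j" "Copy c ?k" t' u]
      nxt_neq[OF i] t'(1) u by auto
  moreover have "t (Copy c ?k) = t' (Copy c ?k) \<longleftrightarrow> t (Base ?k) = t' (Base ?k)"
    by (rule side_determined_iff[OF k, of "Base i"])
      (use S(1) t t' nxt_neq[OF k] nxt_nxt_nxt[OF i] in \<open>auto simp: side_def\<close>)
  ultimately show ?thesis using v(2) w(2) t'(4) by auto
qed

lemma realizes_common_outcome:
  assumes R: "[c, b, a] \<in> R" and i: "i \<in> {1, 2, 3}"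
    and p: "p \<in> shifts a" and q: "q \<in> shifts b"
  obtains u where "u \<in> T" "realizes p a i u" "realizes q b (nxt i) u"
proof -
  note S = relator_in_S[OF R] and j = nxt_closed[OF i]
  obtain v where v: "v \<in> T" "realizes p a i v" using shiftsE[OF p i] .
  obtain w where w: "w \<in> T" "realizes q b (nxt i) w" using shiftsE[OF q j] .
  obtain u where u: "u \<in> T" "u (Copy a i) = v (Copy a i)" "u (Copy b (nxt i)) = w (Copy b (nxt i))"
    using pair_independent[OF copy_in_ground[OF i S(3)] copy_in_ground[OF j S(2)] _ v(1) w(1)]
      nxt_neq[OF i] by auto
  then have "realizes p a i u" "realizes q b (nxt i) u"
    using v(2) w(2) realizes_cong by metis+
  then show thesis using u(1) that by blast
qed

lemma shift_relator:
  assumes R: "[c, b, a] \<in> R" and p: "p \<in> shifts a" and q: "q \<in> shifts b"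
  shows "inv\<^bsub>BijGroup base_values\<^esub> (q \<otimes>\<^bsub>BijGroup base_values\<^esub> p) \<in> shifts c"
proof -
  have pq: "p \<in> Bij base_values" "q \<in> Bij base_values"
    using p q shifts_subset by blast+
  let ?f = "compose base_values q p"
  let ?r = "inv\<^bsub>BijGroup base_values\<^esub> ?f"
  have f: "?f \<in> Bij base_values" using pq(2,1) by (rule compose_Bij)
  have "?r \<in> Bij base_values"
    using restrict_inv_into_Bij[OF f] inv_BijGroup[OF f] by simp
  moreover have "\<exists>u\<in>T. realizes ?r c k u" if k: "k \<in> {1, 2, 3}" for k
  proof -
    let ?i = "nxt k"
    have i: "?i \<in> {1, 2, 3}" using k by (rule nxt_closed)
    obtain u where u: "u \<in> T" "realizes p a ?i u" "realizes q b (nxt ?i) u"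
      using realizes_common_outcome[OF R i p q] .
    have "?r (k, t (Base k)) = (?i, t (Base ?i)) \<longleftrightarrow> q (p (?i, t (Base ?i))) = (k, t (Base k))"
      if "t \<in> T" for t
      using inv_BijGroup_eq_iff[OF f base_valuesI[OF k that] base_valuesI[OF i that]]
        base_valuesI[OF i that]
      by (simp add: compose_def)
    then have "realizes ?r c k u"
      using realizes_compose[OF R i u] nxt_nxt_nxt[OF k] by (simp add: realizes_def)
    then show ?thesis using u(1) by blast
  qed
  ultimately have "?r \<in> shifts c" unfolding shifts_def by blast
  then show ?thesis using pq by (simp add: BijGroup_def)
qed

lemma triangular_family_shifts: "triangular_family (BijGroup base_values) e sinv S R shifts"
proof (intro triangular_family.intro triangular_family_axioms.intro)
  show "group (BijGroup base_values)" by (rule group_BijGroup)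
  show "triangular_presentation e sinv S R" by (rule triangular_presentation_axioms)
  show "shifts s \<subseteq> carrier (BijGroup base_values)" for s
    using shifts_subset by (simp add: BijGroup_def)
qed (fact shifts_nonempty shift_relator)+

lemma inj_on_shifts: "inj_on shifts S"
  using shifts_disjoint shifts_nonempty by (intro inj_onI) (metis inf.idem)

theorem separating_hom:
  assumes "has_presentation G \<iota> S (insert [e] R)"
  obtains n \<rho> where "\<rho> \<in> hom G (sym_group n)" and "inj_on (\<rho> \<circ> \<iota>) S"
proof (rule triangular_family.separating_hom[OF triangular_family_shifts _ inj_on_shifts assms])
  show "finite (carrier (BijGroup base_values))"
    using finite_Bij[OF finite_base_values] by (simp add: BijGroup_def)
qed (rule that)

end

section \<open>Entropic Dowling geometries\<close>

locale entropic_dowling =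
  triangular_presentation e sinv S R +
  entropy_representation "dowling_ground S" "dowling_rank S R" D c
  for e :: 's and sinv S R and D :: "('s dowling_elem \<Rightarrow> 'v) pmf" and c
begin

abbreviation rank :: "'s dowling_elem set \<Rightarrow> nat" where
  "rank \<equiv> dowling_rank S R"

lemma rank_pair:
  assumes "x \<in> dowling_ground S" "y \<in> dowling_ground S" "x \<noteq> y"
  shows "rank {x, y} = rank {x} + rank {y}"
  using assms by (simp add: dowling_rank_le_two)

lemma rank_line:
  assumes "L \<in> dowling_lines S R" "{x, y, z} \<subseteq> L" "x \<noteq> y"
  shows "rank {x, y, z} = rank {x, y}"
proof -
  have "{x, y, z} \<subseteq> dowling_ground S"
    using dowling_line_subset_ground[OF assms(1)] assms(2) by blast
  moreover have "2 \<le> card {x, y, z}"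
    using assms(3) card_mono[of "{x, y, z}" "{x, y}"] by simp
  ultimately show ?thesis
    using dowling_rank_collinear[OF _ _ _ assms(1,2)] assms(3) by (simp add: dowling_rank_le_two)
qed

lemma finite_values_line:
  assumes L: "L \<in> dowling_lines S R" "{x, y, z} \<subseteq> L" and distinct: "x \<noteq> y" "x \<noteq> z" "y \<noteq> z"
  shows "finite ((\<lambda>t. t y) ` set_pmf D)"
proof (rule finite_values)
  have "{x, y, z} \<subseteq> dowling_ground S"
    using dowling_line_subset_ground[OF L(1)] L(2) by blast
  then show "x \<in> dowling_ground S" "y \<in> dowling_ground S" "z \<in> dowling_ground S" by auto
  then show "rank {x, y} = rank {x} + rank {y}"
    "rank {x, z} = rank {x} + rank {z}" "rank {y, z} = rank {y} + rank {z}"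
    using distinct by (auto intro: rank_pair)
  show "rank {x, y, z} = rank {x, y}"
    using L distinct(1) by (rule rank_line)
  show "rank {x, y, z} = rank {x, z}"
    using rank_line[OF L(1), of x z y] L(2) distinct(2) by (simp add: insert_commute)
qed

lemma independent_points:
  assumes "x \<in> dowling_ground S" "y \<in> dowling_ground S" "x \<noteq> y" "t \<in> set_pmf D" "t' \<in> set_pmf D"
  shows "\<exists>u\<in>set_pmf D. u x = t x \<and> u y = t' y"
proof -
  obtain u where "u \<in> set_pmf D" "\<forall>a\<in>{x}. u a = t a" "\<forall>a\<in>{y}. u a = t' a"
    by (rule independent[of "{x}" "{y}" t t']) (use assms rank_pair in \<open>auto simp: insert_commute\<close>)
  then show ?thesis by auto
qed

lemma independent_bases:
  assumes "t\<^sub>1 \<in> set_pmf D" "t\<^sub>2 \<in> set_pmf D" "t\<^sub>3 \<in> set_pmf D"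
  shows "\<exists>t\<in>set_pmf D.
    t (Base 1) = t\<^sub>1 (Base 1) \<and> t (Base 2) = t\<^sub>2 (Base 2) \<and> t (Base 3) = t\<^sub>3 (Base 3)"
proof -
  have base: "Base i \<in> dowling_ground S" if "i \<in> {1, 2, 3}" for i
    using that by (rule base_in_ground)
  obtain t\<^sub>1\<^sub>2 where t\<^sub>1\<^sub>2: "t\<^sub>1\<^sub>2 \<in> set_pmf D"
      "t\<^sub>1\<^sub>2 (Base 1) = t\<^sub>1 (Base 1)" "t\<^sub>1\<^sub>2 (Base 2) = t\<^sub>2 (Base 2)"
    using independent_points[of "Base 1" "Base 2" t\<^sub>1 t\<^sub>2] base assms by auto
  have "rank ({Base 1, Base 2} \<union> {Base 3}) = rank {Base 1, Base 2} + rank {Base 3}"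
    using base dowling_rank_bases[of S R] by (simp add: dowling_rank_le_two insert_commute)
  then obtain t where "t \<in> set_pmf D"
      "\<forall>a\<in>{Base 1, Base 2}. t a = t\<^sub>1\<^sub>2 a" "\<forall>a\<in>{Base 3}. t a = t\<^sub>3 a"
    using independent[of "{Base 1, Base 2}" "{Base 3}" t\<^sub>1\<^sub>2 t\<^sub>3] base assms t\<^sub>1\<^sub>2(1) by auto
  then show ?thesis using t\<^sub>1\<^sub>2 by auto
qed

sublocale dowling_support e sinv S R "set_pmf D"
proof
  fix i :: nat assume i: "i \<in> {1, 2, 3}"
  show "finite ((\<lambda>t. t (Base i)) ` set_pmf D)"
    by (rule finite_values_line[OF side_in_dowling_lines[OF i], of "Base (nxt i)" _ "Copy e i"])
      (use nxt_neq[OF i] e_in_S in \<open>auto simp: side_def\<close>)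
next
  have "rank {Base 1} \<noteq> 0"
    using base_in_ground[of 1 S] by (simp add: dowling_rank_le_two)
  then show "\<exists>t\<in>set_pmf D. \<exists>t'\<in>set_pmf D. t (Base 1) \<noteq> t' (Base 1)"
    using nonconstant[of "Base 1"] base_in_ground[of 1] by blast
next
  fix L and x y z :: "'s dowling_elem" and t t'
  assume L: "L \<in> dowling_lines S R" "{x, y, z} \<subseteq> L" "x \<noteq> y"
    and t: "t \<in> set_pmf D" "t' \<in> set_pmf D" "t x = t' x" "t y = t' y"
  show "t z = t' z"
    by (rule determined[of "{x, y}" "{x, y, z}"])
      (use L t rank_line[OF L] dowling_line_subset_ground[OF L(1)] in auto)
qed (fact independent_points independent_bases)+

end

theorem theorem4p5:
  fixes G :: "('g, 'b) monoid_scheme" and \<iota> :: "'s \<Rightarrow> 'g"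
    and e :: 's and sinv :: "'s \<Rightarrow> 's" and S :: "'s set" and R :: "'s list set"
  assumes "symmetric_triangular e sinv S R"
    and "has_presentation G \<iota> S (insert [e] R)"
    and "entropic TYPE('w) TYPE('v) (dowling_ground S) (dowling_rank S R)"
  shows "\<exists>(n :: nat) \<rho>. \<rho> \<in> hom G (sym_group n) \<and>
    (\<forall>s\<in>S. \<forall>s'\<in>S. s \<noteq> s' \<longrightarrow> \<rho> (\<iota> s) \<noteq> \<rho> (\<iota> s'))"
proof -
  obtain D :: "('s dowling_elem \<Rightarrow> 'v) pmf" and c
    where D: "entropy_representation (dowling_ground S) (dowling_rank S R) D c"
    using assms(3) by (rule entropic_imp_representation)
  interpret entropic_dowling e sinv S R D c
    using assms(1) D by (intro entropic_dowling.intro triangular_presentation.intro)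
  obtain n \<rho> where "\<rho> \<in> hom G (sym_group n)" "inj_on (\<rho> \<circ> \<iota>) S"
    using assms(2) by (rule separating_hom)
  then show ?thesis by (auto simp: inj_on_def)
qed

end
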